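(* Consider the $2$-vertex directed graph IFS on $\mathbb{R}$ described in the context, with attractors $F_u,F_v$, and let $s=\dim_{\rm H}F_u=\dim_{\rm H}F_v$, $h_u=\mathcal{H}^s(F_u)$, $h_v=\mathcal{H}^s(F_v)$. Suppose that $$(1)\ |I_u|=|I_v|,\qquad (2)\ \frac{h_v}{h_u}\leq 1,\qquad (3)\ \frac{(a+g_u)(|I_u|^s-a^s)}{b\,a^s}\geq 1 .$$ Then $$\mathcal{H}^s(F_u)=|I_u|^s\quad\text{and}\quad \mathcal{H}^s(F_v)=|I_u|^s\left(\frac{1-r_{e_1}^s}{r_{e_2}^s}\right).$$
   Context: The $2$-vertex IFS: let $I_u=[a_u,b_u]$, $I_v=[a_v,b_v]$ be non-degenerate closed intervals in $\mathbb{R}$, and let $a,g_u,b,c,g_v,d>0$ satisfy $|I_u|=b_u-a_u=a+g_u+b$ and $|I_v|=b_v-a_v=c+g_v+d$. Put $r_{e_1}=a/|I_u|$, $r_{e_2}=b/|I_v|$, $r_{e_3}=c/|I_v|$, $r_{e_4}=d/|I_u|$, all of which are assumed to lie in $(0,1)$, and define similarities of $\mathbb{R}$ by $S_{e_1}(x)=r_{e_1}(x-a_u)+a_u$, $S_{e_2}(x)=r_{e_2}(x-a_v)+a_u+a+g_u$, $S_{e_3}(x)=r_{e_3}(x-a_v)+a_v$, $S_{e_4}(x)=r_{e_4}(x-a_u)+a_v+c+g_v$. The directed graph has vertices $u,v$; $e_1$ is a loop at $u$, $e_2$ goes from $u$ to $v$, $e_3$ is a loop at $v$, $e_4$ goes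 from $v$ to $u$. The attractors are the unique non-empty compact sets $F_u,F_v\subset\mathbb{R}$ with $F_u=S_{e_1}(F_u)\cup S_{e_2}(F_v)$ and $F_v=S_{e_3}(F_v)\cup S_{e_4}(F_u)$. The convex hulls of $F_u,F_v$ are $I_u,I_v$. Known background: $s$ is the unique non-negative real for which the matrix with rows $(r_{e_1}^s, r_{e_2}^s)$ and $(r_{e_4}^s, r_{e_3}^s)$ has spectral radius $1$, and $0<\mathcal{H}^s(F_u),\mathcal{H}^s(F_v)<+\infty$. $\mathcal{H}^s$ is $s$-dimensional Hausdorff measure normalised using $\sum_i|U_i|^s$ over covers, with no additional constant; $|\cdot|$ is diameter. *)

theory Defs
  imports "HOL-Analysis.Analysis"
begin

text \<open>
  The conventions are that the empty set has gauge \<open>0\<close> for every \<open>s\<close>, and that \<open>0\<^sup>0 = 1\<close>, so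
  that \<open>\<H>\<^sup>0\<close> is counting measure. Isabelle has \<open>0 powr 0 = 0\<close>, hence the case split.
\<close>
definition diam_gauge :: "real \<Rightarrow> 'a::metric_space set \<Rightarrow> ennreal" where
  "diam_gauge s U =
     (if U = {} then 0 else if s = 0 then 1 else ennreal (diameter U powr s))"

text \<open>
  Boundedness of the covering sets is required because \<^const>\<open>diameter\<close> is real-valued and
  carries no information on unbounded sets. Finite covers are included by padding with \<open>{}\<close>.
\<close>
definition hausdorff_premeasure :: "real \<Rightarrow> real \<Rightarrow> 'a::metric_space set \<Rightarrow> ennreal" where
  "hausdorff_premeasure s \<delta> A =
     (INF U \<in> {U :: nat \<Rightarrow> 'a set. A \<subseteq> (\<Union>i. U i) \<and> (\<forall>i. bounded (U i) \<and> diameter (U i) \<le> \<delta>)}.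
        \<Sum>i. diam_gauge s (U i))"

text \<open>The supremum over \<open>\<delta> > 0\<close> is the limit as \<open>\<delta> \<rightarrow> 0\<close>, by monotonicity in \<open>\<delta>\<close>.\<close>
definition hausdorff_measure :: "real \<Rightarrow> 'a::metric_space set \<Rightarrow> ennreal" where
  "hausdorff_measure s A = (SUP \<delta> \<in> {0<..}. hausdorff_premeasure s \<delta> A)"

definition hausdorff_dim :: "'a::metric_space set \<Rightarrow> ereal" where
  "hausdorff_dim A = Inf {ereal s | s. 0 \<le> s \<and> hausdorff_measure s A = 0}"

text \<open>The similarity of the line with ratio \<open>r\<close> that sends \<open>p\<close> to \<open>q\<close>.\<close>
definition line_similarity :: "real \<Rightarrow> real \<Rightarrow> real \<Rightarrow> real \<Rightarrow> real" where
  "line_similarity r p q x = r * (x - p) + q"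

text \<open>
  The attractors of the directed graph IFS with vertices \<open>u\<close>, \<open>v\<close>, loops \<open>e\<^sub>1\<close> at \<open>u\<close> and
  \<open>e\<^sub>3\<close> at \<open>v\<close>, and edges \<open>e\<^sub>2\<close> from \<open>u\<close> to \<open>v\<close> and \<open>e\<^sub>4\<close> from \<open>v\<close> to \<open>u\<close>. For contractions
  exactly one pair \<open>(F\<^sub>u, F\<^sub>v)\<close> satisfies this predicate.
\<close>
definition two_vertex_attractors ::
  "(real \<Rightarrow> real) \<Rightarrow> (real \<Rightarrow> real) \<Rightarrow> (real \<Rightarrow> real) \<Rightarrow> (real \<Rightarrow> real)
     \<Rightarrow> real set \<Rightarrow> real set \<Rightarrow> bool" where
  "two_vertex_attractors S1 S2 S3 S4 Fu Fv \<longleftrightarrow>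
     compact Fu \<and> Fu \<noteq> {} \<and> compact Fv \<and> Fv \<noteq> {} \<and>
     Fu = S1 ` Fu \<union> S2 ` Fv \<and> Fv = S3 ` Fv \<union> S4 ` Fu"

end

theory Submission
  imports Defs
begin

text \<open>
  After rescaling both hulls to \<open>[0,1]\<close> the claim is that \<open>\<H>\<^sup>s(F\<^sub>u) = 1\<close> and \<open>\<H>\<^sup>s(F\<^sub>v) = t\<close>, where \<open>(1, t)\<close>
  is the eigenvector for the eigenvalue \<open>1\<close> of the matrix \<open>M\<close> of the powers \<open>r\<^sup>s\<close>.

  That the exponent \<open>s\<close> is the Hausdorff dimension is proved along the way. The characteristic
  equation of \<open>M\<close> has a root in \<open>(0,1]\<close> (\<open>weights_exist\<close>), and for this exponent both measures are
  finite (\<open>hausdorff_measure_finite\<close>) and positive (\<open>hausdorff_measure_pos\<close>). Subadditivity alone then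
  forces the measures to be proportional to the eigenvector (\<open>hausdorff_measure_proportional\<close>).

  Upper bound: refining a cover by the first-level maps acts on the vector of premeasures by \<open>M\<close>, and
  a left eigenvector of \<open>M\<close> shows that nothing is gained by using fine covers. The single set \<open>F\<^sub>u\<close>
  therefore gives \<open>\<H>\<^sup>s(F\<^sub>u) \<le> 1\<close> (\<open>hausdorff_measure_le_1\<close>).

  Lower bound: by the mass distribution principle it suffices that every interval of length \<open>\<ell>\<close> has
  natural mass at most \<open>\<ell>\<^sup>s\<close> (\<open>mass_le_length_powr\<close>). By self-similarity only intervals across the gap
  between the two first-level pieces matter. For them the estimates for the two parts are combined by
  Jensen's inequality for \<open>x\<^sup>s\<close>, provided that the right piece carries enough mass relative to its
  length: \<open>r\<^sub>1\<^sup>s \<le> 1 - r\<^sub>2\<close> at \<open>u\<close> and \<open>r\<^sub>3\<^sup>s \<le> 1 - r\<^sub>4\<close> at \<open>v\<close>. The first inequality is a rewriting of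
  hypothesis (3), the second one follows from \<open>t \<le> 1\<close>, which is hypothesis (2) because of the proportionality.
\<close>

section \<open>Hausdorff premeasures\<close>

lemma hausdorff_premeasure_le_cover:
  assumes "A \<subseteq> (\<Union>i. U i)" "\<And>i. bounded (U i)" "\<And>i. diameter (U i) \<le> \<delta>"
  shows "hausdorff_premeasure s \<delta> A \<le> (\<Sum>i::nat. diam_gauge s (U i))"
  unfolding hausdorff_premeasure_def using assms by (intro INF_lower) auto

lemma hausdorff_premeasure_ge:
  assumes "\<And>U. A \<subseteq> (\<Union>i. U i) \<Longrightarrow> (\<And>i. bounded (U i)) \<Longrightarrow> (\<And>i. diameter (U i) \<le> \<delta>) \<Longrightarrow>
      x \<le> (\<Sum>i::nat. diam_gauge s (U i))"
  shows "x \<le> hausdorff_premeasure s \<delta> A"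
  unfolding hausdorff_premeasure_def using assms by (intro INF_greatest) auto

lemma hausdorff_premeasure_antimono:
  assumes "\<delta> \<le> \<epsilon>"
  shows "hausdorff_premeasure s \<epsilon> A \<le> hausdorff_premeasure s \<delta> A"
  using assms
  by (intro hausdorff_premeasure_ge hausdorff_premeasure_le_cover) (auto intro: order_trans)

lemma hausdorff_premeasure_le_measure:
  assumes "\<delta> > 0"
  shows "hausdorff_premeasure s \<delta> A \<le> hausdorff_measure s A"
  unfolding hausdorff_measure_def using assms by (intro SUP_upper) auto

text \<open>
  Along a geometric sequence of scales a self-similarity relation turns into a recursion, so
  the limit \<open>\<delta> \<rightarrow> 0\<close> is taken along sequences.
\<close>
lemma hausdorff_measure_eq_SUP_seq:
  assumes "\<And>k. \<delta> k > 0" "\<delta> \<longlonglongrightarrow> 0"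
  shows "hausdorff_measure s A = (SUP k. hausdorff_premeasure s (\<delta> k) A)"
proof (rule antisym)
  show "hausdorff_measure s A \<le> (SUP k. hausdorff_premeasure s (\<delta> k) A)"
    unfolding hausdorff_measure_def
  proof (rule SUP_least)
    fix \<epsilon> :: real assume "\<epsilon> \<in> {0<..}"
    then obtain k where "\<delta> k < \<epsilon>"
      using order_tendstoD(2)[OF assms(2), of \<epsilon>] by (auto simp: eventually_sequentially)
    then show "hausdorff_premeasure s \<epsilon> A \<le> (SUP k. hausdorff_premeasure s (\<delta> k) A)"
      by (intro SUP_upper2[of k] hausdorff_premeasure_antimono) auto
  qed
next
  show "(SUP k. hausdorff_premeasure s (\<delta> k) A) \<le> hausdorff_measure s A"
    by (intro SUP_least hausdorff_premeasure_le_measure assms(1))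
qed

text \<open>
  Two near-optimal covers are interleaved: one takes the even indices, the other the odd ones.
\<close>
lemma hausdorff_premeasure_Un:
  "hausdorff_premeasure s \<delta> (A \<union> B) \<le> hausdorff_premeasure s \<delta> A + hausdorff_premeasure s \<delta> B"
proof -
  have cover: "hausdorff_premeasure s \<delta> (A \<union> B) \<le>
      (\<Sum>i. diam_gauge s (U i)) + (\<Sum>i. diam_gauge s (V i))"
    if U: "A \<subseteq> (\<Union>i. U i)" "\<And>i. bounded (U i)" "\<And>i. diameter (U i) \<le> \<delta>"
      and V: "B \<subseteq> (\<Union>i. V i)" "\<And>i. bounded (V i)" "\<And>i. diameter (V i) \<le> \<delta>"
    for U V :: "nat \<Rightarrow> 'a set"
  proof -
    define W where "W i = (if even i then U (i div 2) else V (i div 2))" for i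
    have "W (2 * i) = U i" "W (2 * i + 1) = V i" for i
      by (simp_all add: W_def)
    then have "(\<Union>i. U i) \<subseteq> (\<Union>i. W i)" "(\<Union>i. V i) \<subseteq> (\<Union>i. W i)"
      by (metis UN_least UN_upper UNIV_I)+
    then have sub: "A \<union> B \<subseteq> (\<Union>i. W i)"
      using U(1) V(1) by (meson Un_least order_trans)
    have W2: "(\<Sum>i<2*n. diam_gauge s (W i)) =
        (\<Sum>i<n. diam_gauge s (U i)) + (\<Sum>i<n. diam_gauge s (V i))" for n
      by (induction n) (simp_all add: W_def add.assoc add.left_commute)
    have "hausdorff_premeasure s \<delta> (A \<union> B) \<le> (\<Sum>i. diam_gauge s (W i))"
      by (rule hausdorff_premeasure_le_cover[OF sub]) (simp_all add: W_def U V)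
    also have "\<dots> \<le> (\<Sum>i. diam_gauge s (U i)) + (\<Sum>i. diam_gauge s (V i))"
    proof (rule suminf_le_const)
      fix n
      have "(\<Sum>i<n. diam_gauge s (W i)) \<le> (\<Sum>i<2*n. diam_gauge s (W i))"
        by (rule sum_mono2) auto
      also have "\<dots> \<le> (\<Sum>i. diam_gauge s (U i)) + (\<Sum>i. diam_gauge s (V i))"
        unfolding W2 by (intro add_mono sum_le_suminf) auto
      finally show "(\<Sum>i<n. diam_gauge s (W i)) \<le>
        (\<Sum>i. diam_gauge s (U i)) + (\<Sum>i. diam_gauge s (V i))" .
    qed auto
    finally show ?thesis .
  qed
  show ?thesis
  proof (rule ennreal_le_epsilon)
    fix e :: real
    assume fin: "hausdorff_premeasure s \<delta> A + hausdorff_premeasure s \<delta> B < top" and "0 < e"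
    have near: "\<exists>U. C \<subseteq> (\<Union>i. U i) \<and> (\<forall>i. bounded (U i) \<and> diameter (U i) \<le> \<delta>) \<and>
        (\<Sum>i. diam_gauge s (U i)) \<le> hausdorff_premeasure s \<delta> C + ennreal (e/2)"
      if "hausdorff_premeasure s \<delta> C < top" for C
    proof -
      have "hausdorff_premeasure s \<delta> C < hausdorff_premeasure s \<delta> C + ennreal (e/2)"
        using that \<open>0 < e\<close> by (cases "hausdorff_premeasure s \<delta> C") (auto simp flip: ennreal_plus intro!: ennreal_lessI)
      then obtain U where "U \<in> {U. C \<subseteq> (\<Union>i. U i) \<and> (\<forall>i. bounded (U i) \<and> diameter (U i) \<le> \<delta>)}"
          "(\<Sum>i. diam_gauge s (U i)) < hausdorff_premeasure s \<delta> C + ennreal (e/2)"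
        unfolding hausdorff_premeasure_def[of s \<delta> C] INF_less_iff by blast
      then show ?thesis by (intro exI[of _ U]) (simp add: less_imp_le)
    qed
    have "hausdorff_premeasure s \<delta> A < top" "hausdorff_premeasure s \<delta> B < top"
      using fin by (simp_all add: ennreal_add_less_top)
    from near[OF this(1)] near[OF this(2)] obtain U V where
      U: "A \<subseteq> (\<Union>i. U i)" "\<And>i. bounded (U i)" "\<And>i. diameter (U i) \<le> \<delta>"
         "(\<Sum>i. diam_gauge s (U i)) \<le> hausdorff_premeasure s \<delta> A + ennreal (e/2)"
      and V: "B \<subseteq> (\<Union>i. V i)" "\<And>i. bounded (V i)" "\<And>i. diameter (V i) \<le> \<delta>"
         "(\<Sum>i. diam_gauge s (V i)) \<le> hausdorff_premeasure s \<delta> B + ennreal (e/2)"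
      by blast
    have "hausdorff_premeasure s \<delta> (A \<union> B) \<le>
        (hausdorff_premeasure s \<delta> A + ennreal (e/2)) + (hausdorff_premeasure s \<delta> B + ennreal (e/2))"
      using cover[OF U(1-3) V(1-3)] add_mono[OF U(4) V(4)] by (rule order_trans)
    also have "\<dots> = hausdorff_premeasure s \<delta> A + hausdorff_premeasure s \<delta> B + (ennreal (e/2) + ennreal (e/2))"
      by (simp add: ac_simps)
    also have "ennreal (e/2) + ennreal (e/2) = ennreal e"
      using \<open>0 < e\<close> by (simp flip: ennreal_plus)
    finally show "hausdorff_premeasure s \<delta> (A \<union> B) \<le>
        hausdorff_premeasure s \<delta> A + hausdorff_premeasure s \<delta> B + ennreal e" .
  qed
qed

lemma diam_gauge_lipschitz_image:
  fixes f :: "'a::metric_space \<Rightarrow> 'b::metric_space"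
  assumes lip: "\<And>x y. dist (f x) (f y) \<le> r * dist x y" and "r > 0" "s \<ge> 0" and U: "bounded U"
  shows "bounded (f ` U)" "diameter (f ` U) \<le> r * diameter U"
    "diam_gauge s (f ` U) \<le> ennreal (r powr s) * diam_gauge s U"
proof -
  show bdd: "bounded (f ` U)"
  proof -
    obtain x e where "\<And>y. y \<in> U \<Longrightarrow> dist x y \<le> e" using U by (auto simp: bounded_def)
    then have "dist (f x) (f y) \<le> r * e" if "y \<in> U" for y
      using order_trans[OF lip[of x y] mult_left_mono[of "dist x y" e r]] \<open>r > 0\<close> \<open>\<And>y. y \<in> U \<Longrightarrow> dist x y \<le> e\<close>[OF that] by simp
    then show ?thesis by (auto simp: bounded_def)
  qed
  show diam: "diameter (f ` U) \<le> r * diameter U"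
  proof (cases "U = {}")
    case False
    have "dist (f x) (f y) \<le> r * diameter U" if "x \<in> U" "y \<in> U" for x y
      using order_trans[OF lip[of x y] mult_left_mono[OF diameter_bounded_bound[OF U that], of r]] \<open>r > 0\<close> by simp
    then show ?thesis
      using False by (auto simp: diameter_def[of "f ` U"] intro!: cSUP_least)
  qed auto
  have "diameter (f ` U) powr s \<le> r powr s * diameter U powr s"
    using powr_mono2[OF \<open>s \<ge> 0\<close> diameter_ge_0[OF bdd] diam] diameter_ge_0[OF U] \<open>r > 0\<close>
    by (simp add: powr_mult)
  then show "diam_gauge s (f ` U) \<le> ennreal (r powr s) * diam_gauge s U"
    using \<open>r > 0\<close> ennreal_leI[of "diameter (f ` U) powr s" "r powr s * diameter U powr s"]
    by (simp add: diam_gauge_def ennreal_mult)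
qed

section \<open>Lipschitz images and dimension\<close>

text \<open>
  Multiplication by a positive real constant is invertible, so an estimate that holds for every
  admissible cover passes to the infimum.
\<close>
lemma le_mult_hausdorff_premeasure:
  assumes "c > 0"
    and "\<And>U. A \<subseteq> (\<Union>i. U i) \<Longrightarrow> (\<And>i. bounded (U i)) \<Longrightarrow> (\<And>i. diameter (U i) \<le> \<delta>) \<Longrightarrow>
      x \<le> ennreal c * (\<Sum>i::nat. diam_gauge s (U i))"
  shows "x \<le> ennreal c * hausdorff_premeasure s \<delta> A"
proof -
  have inv: "ennreal (inverse c) * ennreal c = 1" "ennreal c * ennreal (inverse c) = 1"
    using \<open>c > 0\<close> by (simp_all flip: ennreal_mult)
  have "ennreal (inverse c) * x \<le> hausdorff_premeasure s \<delta> A"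
  proof (rule hausdorff_premeasure_ge)
    fix U :: "nat \<Rightarrow> 'a set"
    assume "A \<subseteq> (\<Union>i. U i)" "\<And>i. bounded (U i)" "\<And>i. diameter (U i) \<le> \<delta>"
    from mult_left_mono[OF assms(2)[OF this], of "ennreal (inverse c)"]
    show "ennreal (inverse c) * x \<le> (\<Sum>i. diam_gauge s (U i))"
      by (simp add: inv mult.assoc[symmetric])
  qed
  from mult_left_mono[OF this, of "ennreal c"] show ?thesis
    by (simp add: inv mult.assoc[symmetric])
qed

lemma hausdorff_premeasure_lipschitz_image:
  fixes f :: "'a::metric_space \<Rightarrow> 'b::metric_space"
  assumes "\<And>x y. dist (f x) (f y) \<le> r * dist x y" and "r > 0" "s \<ge> 0"
  shows "hausdorff_premeasure s (r * \<delta>) (f ` A) \<le> ennreal (r powr s) * hausdorff_premeasure s \<delta> A"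
proof (rule le_mult_hausdorff_premeasure)
  fix U :: "nat \<Rightarrow> 'a set"
  assume U: "A \<subseteq> (\<Union>i. U i)" "\<And>i. bounded (U i)" "\<And>i. diameter (U i) \<le> \<delta>"
  note image = diam_gauge_lipschitz_image[OF assms U(2)]
  have "hausdorff_premeasure s (r * \<delta>) (f ` A) \<le> (\<Sum>i. diam_gauge s (f ` U i))"
  proof (rule hausdorff_premeasure_le_cover)
    show "f ` A \<subseteq> (\<Union>i. f ` U i)" using U(1) by (auto simp: image_UN[symmetric])
    show "diameter (f ` U i) \<le> r * \<delta>" for i
      using order_trans[OF image(2) mult_left_mono[OF U(3), of r]] \<open>r > 0\<close> by simp
  qed (rule image)
  also have "\<dots> \<le> (\<Sum>i. ennreal (r powr s) * diam_gauge s (U i))"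
    by (intro suminf_le image(3)) auto
  finally show "hausdorff_premeasure s (r * \<delta>) (f ` A) \<le>
      ennreal (r powr s) * (\<Sum>i. diam_gauge s (U i))" by simp
qed (use \<open>r > 0\<close> in simp)

lemma hausdorff_measure_lipschitz_image:
  fixes f :: "'a::metric_space \<Rightarrow> 'b::metric_space"
  assumes "\<And>x y. dist (f x) (f y) \<le> r * dist x y" and "r > 0" "s \<ge> 0"
  shows "hausdorff_measure s (f ` A) \<le> ennreal (r powr s) * hausdorff_measure s A"
  unfolding hausdorff_measure_def[of s "f ` A"]
proof (rule SUP_least)
  fix \<epsilon> :: real assume "\<epsilon> \<in> {0<..}"
  then have "hausdorff_premeasure s \<epsilon> (f ` A) \<le>
      ennreal (r powr s) * hausdorff_premeasure s (\<epsilon> / r) A"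
    using hausdorff_premeasure_lipschitz_image[OF assms, of "\<epsilon> / r" A] \<open>r > 0\<close> by simp
  also have "\<dots> \<le> ennreal (r powr s) * hausdorff_measure s A"
    using \<open>\<epsilon> \<in> {0<..}\<close> \<open>r > 0\<close>
    by (intro mult_left_mono hausdorff_premeasure_le_measure) auto
  finally show "hausdorff_premeasure s \<epsilon> (f ` A) \<le> ennreal (r powr s) * hausdorff_measure s A" .
qed

text \<open>
  Each inequality is the Lipschitz estimate, applied to the map and to its inverse.
\<close>
lemma hausdorff_measure_affine_image:
  fixes A :: "real set"
  assumes "r > 0" "s \<ge> 0"
  shows "hausdorff_measure s ((\<lambda>x. r * x + q) ` A) = ennreal (r powr s) * hausdorff_measure s A"
    (is "hausdorff_measure s (?f ` A) = _")
proof (rule antisym)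
  have "dist (?f x) (?f y) = r * dist x y" for x y
  proof -
    have "?f x - ?f y = r * (x - y)" by (simp add: algebra_simps)
    then show ?thesis using assms by (simp add: dist_real_def abs_mult)
  qed
  then show "hausdorff_measure s (?f ` A) \<le> ennreal (r powr s) * hausdorff_measure s A"
    using assms by (intro hausdorff_measure_lipschitz_image) simp_all
  let ?g = "\<lambda>y. (y - q) / r"
  have "dist (?g x) (?g y) \<le> (1/r) * dist x y" for x y
    using assms by (simp add: dist_real_def diff_divide_distrib[symmetric])
  then have "hausdorff_measure s (?g ` ?f ` A) \<le>
      ennreal ((1/r) powr s) * hausdorff_measure s (?f ` A)"
    using assms by (intro hausdorff_measure_lipschitz_image) auto
  moreover have "?g ` ?f ` A = A"
    using assms by (auto simp: image_image)
  ultimately have "ennreal (r powr s) * hausdorff_measure s A \<le>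
      ennreal (r powr s) * (ennreal ((1/r) powr s) * hausdorff_measure s (?f ` A))"
    by (simp add: mult_left_mono)
  also have "ennreal (r powr s) * (ennreal ((1/r) powr s) * hausdorff_measure s (?f ` A)) =
      ennreal (r powr s * (1/r) powr s) * hausdorff_measure s (?f ` A)"
    using assms by (simp add: ennreal_mult mult.assoc)
  also have "r powr s * (1/r) powr s = 1"
    using assms by (simp flip: powr_mult)
  finally show "ennreal (r powr s) * hausdorff_measure s A \<le> hausdorff_measure s (?f ` A)"
    by simp
qed

lemma hausdorff_measure_Un:
  "hausdorff_measure s (A \<union> B) \<le> hausdorff_measure s A + hausdorff_measure s B"
  unfolding hausdorff_measure_def[of s "A \<union> B"]
  by (rule SUP_least, rule order_trans[OF hausdorff_premeasure_Un])
     (auto intro!: add_mono hausdorff_premeasure_le_measure)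

text \<open>
  \<open>|U|\<^sup>t = |U|\<^sup>t\<^sup>-\<^sup>s |U|\<^sup>s\<close>, and the first factor is at most \<open>\<delta>\<^sup>t\<^sup>-\<^sup>s\<close> for covering sets of diameter at
  most \<open>\<delta>\<close>.
\<close>
lemma hausdorff_premeasure_exponent:
  assumes "0 \<le> s" "s < t" "0 < \<delta>"
  shows "hausdorff_premeasure t \<delta> A \<le> ennreal (\<delta> powr (t - s)) * hausdorff_premeasure s \<delta> A"
proof (rule le_mult_hausdorff_premeasure)
  fix U :: "nat \<Rightarrow> 'a set"
  assume U: "A \<subseteq> (\<Union>i. U i)" "\<And>i. bounded (U i)" "\<And>i. diameter (U i) \<le> \<delta>"
  have "diam_gauge t (U i) \<le> ennreal (\<delta> powr (t - s)) * diam_gauge s (U i)" for i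
  proof -
    have le: "diameter (U i) powr (t - s) \<le> \<delta> powr (t - s)"
      using U assms by (intro powr_mono2 diameter_ge_0) auto
    have "diameter (U i) powr t = diameter (U i) powr (t - s) * diameter (U i) powr s"
      by (simp flip: powr_add)
    also have "\<dots> \<le> \<delta> powr (t - s) * diameter (U i) powr s"
      using le by (intro mult_right_mono) auto
    finally show ?thesis
      using assms le by (auto simp: diam_gauge_def ennreal_mult[symmetric] intro!: ennreal_leI)
  qed
  then have "(\<Sum>i. diam_gauge t (U i)) \<le> (\<Sum>i. ennreal (\<delta> powr (t - s)) * diam_gauge s (U i))"
    by (intro suminf_le) auto
  with hausdorff_premeasure_le_cover[OF U, of t]
  show "hausdorff_premeasure t \<delta> A \<le> ennreal (\<delta> powr (t - s)) * (\<Sum>i. diam_gauge s (U i))"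
    by simp
qed (use assms in simp)

lemma hausdorff_measure_eq_0_if_finite_below:
  assumes "0 \<le> s" "s < t" "hausdorff_measure s A < top"
  shows "hausdorff_measure t A = 0"
proof -
  obtain \<eta> where \<eta>: "hausdorff_measure s A = ennreal \<eta>" "\<eta> \<ge> 0"
    using assms(3) by (cases "hausdorff_measure s A") auto
  have "hausdorff_premeasure t \<delta> A = 0" if "\<delta> > 0" for \<delta>
  proof -
    have "hausdorff_premeasure t \<delta> A \<le> 0 + ennreal e" if "e > 0" for e
    proof -
      \<comment> \<open>A scale at which the factor \<open>\<epsilon>\<^sup>t\<^sup>-\<^sup>s\<close> is at most \<open>e / (\<eta> + 1)\<close>.\<close>
      define \<epsilon> where "\<epsilon> = min \<delta> ((e / (\<eta> + 1)) powr (1 / (t - s)))"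
      have pos: "\<epsilon> > 0" using \<open>\<delta> > 0\<close> \<open>e > 0\<close> \<eta> by (simp add: \<epsilon>_def)
      have "\<epsilon> powr (t - s) \<le> ((e / (\<eta> + 1)) powr (1 / (t - s))) powr (t - s)"
        using pos assms by (intro powr_mono2) (auto simp: \<epsilon>_def)
      also have "\<dots> = e / (\<eta> + 1)"
        using assms \<open>e > 0\<close> \<eta> by (simp add: powr_powr)
      finally have "\<epsilon> powr (t - s) * \<eta> \<le> e / (\<eta> + 1) * \<eta>"
        using \<eta> by (intro mult_right_mono) auto
      also have "\<dots> \<le> e" using \<eta> \<open>e > 0\<close> by (simp add: field_simps)
      finally have small: "\<epsilon> powr (t - s) * \<eta> \<le> e" .
      have "hausdorff_premeasure t \<delta> A \<le> hausdorff_premeasure t \<epsilon> A"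
        by (rule hausdorff_premeasure_antimono) (simp add: \<epsilon>_def)
      also have "\<dots> \<le> ennreal (\<epsilon> powr (t - s)) * hausdorff_premeasure s \<epsilon> A"
        by (rule hausdorff_premeasure_exponent[OF assms(1,2) pos])
      also have "\<dots> \<le> ennreal (\<epsilon> powr (t - s)) * ennreal \<eta>"
        unfolding \<eta>(1)[symmetric] by (intro mult_left_mono hausdorff_premeasure_le_measure pos) auto
      also have "\<dots> \<le> ennreal e"
        using small \<eta> by (simp add: ennreal_mult[symmetric] ennreal_leI)
      finally show ?thesis by simp
    qed
    then show ?thesis
      using ennreal_le_epsilon[of 0 "hausdorff_premeasure t \<delta> A"] by simp
  qed
  then show ?thesis by (simp add: hausdorff_measure_def)
qed

lemma hausdorff_dim_eqI:
  assumes "0 \<le> s" "hausdorff_measure s A \<noteq> 0" "hausdorff_measure s A < top"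
  shows "hausdorff_dim A = ereal s"
  unfolding hausdorff_dim_def
proof (rule antisym)
  show "Inf {ereal t | t. 0 \<le> t \<and> hausdorff_measure t A = 0} \<le> ereal s"
  proof (rule ereal_le_epsilon2)
    fix e :: real assume "0 < e"
    then show "Inf {ereal t | t. 0 \<le> t \<and> hausdorff_measure t A = 0} \<le> ereal s + ereal e"
      using assms hausdorff_measure_eq_0_if_finite_below[of s "s + e" A]
      by (intro Inf_lower) (auto intro!: exI[of _ "s + e"])
  qed
  show "ereal s \<le> Inf {ereal t | t. 0 \<le> t \<and> hausdorff_measure t A = 0}"
  proof (rule Inf_greatest, clarsimp)
    fix t :: real assume t: "0 \<le> t" "hausdorff_measure t A = 0"
    show "s \<le> t"
      using hausdorff_measure_eq_0_if_finite_below[of t s A] t assms(2) by (force simp: not_le[symmetric])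
  qed
qed

section \<open>The rescaled two-vertex system\<close>

text \<open>
  The system after rescaling both hulls to \<open>[0,1]\<close>. Vertices are Booleans (\<open>True\<close> is \<open>u\<close>, \<open>False\<close>
  is \<open>v\<close>), which makes the two vertices symmetric: at every vertex the left piece is a loop of ratio
  \<open>\<alpha> w\<close> and the right piece leads to the other vertex with ratio \<open>\<beta> w\<close>. Equal hull lengths are what
  keeps these ratios equal to those of the original system.
\<close>
locale two_vertex_ifs =
  fixes \<alpha> \<beta> :: "bool \<Rightarrow> real" and G :: "bool \<Rightarrow> real set"
  assumes \<alpha>_pos: "0 < \<alpha> w" and \<beta>_pos: "0 < \<beta> w" and gap: "\<alpha> w + \<beta> w < 1"
    and compact_G: "compact (G w)" and G_nonempty: "G w \<noteq> {}"
    and G_eq: "G w = (\<lambda>x. \<alpha> w * x) ` G w \<union> (\<lambda>x. \<beta> w * x + (1 - \<beta> w)) ` G (\<not> w)"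
begin

lemma \<alpha>_less_1: "\<alpha> w < 1" and \<beta>_less_1: "\<beta> w < 1"
  using gap[of w] \<alpha>_pos[of w] \<beta>_pos[of w] by auto

lemma left_image_in_G: "x \<in> G w \<Longrightarrow> \<alpha> w * x \<in> G w"
  using G_eq[of w] by auto

lemma right_image_in_G: "x \<in> G (\<not> w) \<Longrightarrow> \<beta> w * x + (1 - \<beta> w) \<in> G w"
  using G_eq[of w] by auto

lemma G_cases:
  assumes "x \<in> G w"
  obtains y where "y \<in> G w" "x = \<alpha> w * y" | y where "y \<in> G (\<not> w)" "x = \<beta> w * y + (1 - \<beta> w)"
  using assms by (subst (asm) G_eq) auto

lemma compact_union_G: "compact (\<Union>w. G w)"
  by (intro compact_UN compact_G) auto

text \<open>
  The point of \<open>G w\<close> nearest to \<open>0\<close> is moved nearer to \<open>0\<close> by the left map unless it is \<open>0\<close>.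
\<close>
lemma zero_in_G: "0 \<in> G w"
proof -
  obtain x where x: "x \<in> G w" "\<And>y. y \<in> G w \<Longrightarrow> \<bar>x\<bar> \<le> \<bar>y\<bar>"
    using continuous_attains_inf[OF compact_G G_nonempty, of w abs] continuous_on_rabs[OF continuous_on_id]
    by auto
  have "\<bar>x\<bar> \<le> \<alpha> w * \<bar>x\<bar>"
    using x(2)[OF left_image_in_G[OF x(1)]] \<alpha>_pos[of w] by (simp add: abs_mult)
  then have "(1 - \<alpha> w) * \<bar>x\<bar> \<le> 0" by (simp add: algebra_simps)
  then have "x = 0" using \<alpha>_less_1[of w] by (simp add: mult_le_0_iff)
  then show ?thesis using x(1) by simp
qed

text \<open>
  The right maps change the vertex, so the point nearest to \<open>1\<close> is taken in the union of both
  attractors.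
\<close>
lemma one_in_G: "1 \<in> G w"
proof -
  have "(\<Union>w. G w) \<noteq> {}" using G_nonempty by auto
  then obtain x where x: "x \<in> (\<Union>w. G w)" "\<And>y. y \<in> (\<Union>w. G w) \<Longrightarrow> \<bar>1 - x\<bar> \<le> \<bar>1 - y\<bar>"
  proof -
    have "continuous_on (\<Union>w. G w) (\<lambda>x. \<bar>1 - x\<bar>)" by (intro continuous_intros)
    from continuous_attains_inf[OF compact_union_G \<open>_ \<noteq> {}\<close> this] that show thesis by blast
  qed
  then obtain v where v: "x \<in> G v" by auto
  have im: "\<beta> (\<not> v) * x + (1 - \<beta> (\<not> v)) \<in> G (\<not> v)"
    using right_image_in_G[of x "\<not> v"] v by simp
  have "1 - (\<beta> (\<not> v) * x + (1 - \<beta> (\<not> v))) = \<beta> (\<not> v) * (1 - x)" by (simp add: algebra_simps)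
  then have "\<bar>1 - x\<bar> \<le> \<beta> (\<not> v) * \<bar>1 - x\<bar>"
    using x(2)[of "\<beta> (\<not> v) * x + (1 - \<beta> (\<not> v))"] im \<beta>_pos[of "\<not> v"] by (auto simp: abs_mult)
  then have "(1 - \<beta> (\<not> v)) * \<bar>1 - x\<bar> \<le> 0" by (simp add: algebra_simps)
  then have "x = 1" using \<beta>_less_1[of "\<not> v"] by (simp add: mult_le_0_iff)
  then have "1 \<in> G v" "1 \<in> G (\<not> v)" using v im by auto
  then show ?thesis by (cases "w = v") auto
qed

text \<open>
  A point of maximal distance \<open>M > 1/2\<close> from \<open>1/2\<close> would be the image of a point at distance at
  most \<open>M\<close>, and both maps send \<open>[1/2 - M, 1/2 + M]\<close> strictly inside itself.
\<close>
lemma G_subset: "G w \<subseteq> {0..1}"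
proof -
  have "(\<Union>w. G w) \<noteq> {}" using G_nonempty by auto
  then obtain x where x: "x \<in> (\<Union>w. G w)"
      "\<And>y. y \<in> (\<Union>w. G w) \<Longrightarrow> \<bar>y - 1/2\<bar> \<le> \<bar>x - 1/2\<bar>"
  proof -
    have "continuous_on (\<Union>w. G w) (\<lambda>x. \<bar>x - 1/2\<bar>)" by (intro continuous_intros)
    from continuous_attains_sup[OF compact_union_G \<open>_ \<noteq> {}\<close> this] that show thesis by blast
  qed
  then obtain v where v: "x \<in> G v" by auto
  have farthest: "\<bar>y - 1/2\<bar> \<le> \<bar>x - 1/2\<bar>" if "y \<in> G w'" for y w' using x(2) that by auto
  have "\<bar>x - 1/2\<bar> \<le> 1/2"
  proof (rule ccontr)
    define M where "M = \<bar>x - 1/2\<bar>"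
    assume "\<not> \<bar>x - 1/2\<bar> \<le> 1/2"
    then have M: "M > 1/2" by (simp add: M_def)
    have shrink: "r * (M - 1/2) < M - 1/2" "r * (M + 1/2) < M + 1/2" if "r < 1" for r
      using M that by simp_all
    from v show False
    proof (cases rule: G_cases)
      case (1 y)
      have "1/2 - M \<le> y" "y \<le> M + 1/2" using farthest[OF 1(1)] by (auto simp: M_def)
      then have "\<alpha> v * (1/2 - M) \<le> x" "x \<le> \<alpha> v * (M + 1/2)"
        using 1(2) \<alpha>_pos[of v] by auto
      with shrink[OF \<alpha>_less_1[of v]] have "\<bar>x - 1/2\<bar> < M" by (simp add: algebra_simps abs_if)
      then show False by (simp add: M_def)
    next
      case (2 y)
      have "1/2 - M \<le> y" "y \<le> M + 1/2" using farthest[OF 2(1)] by (auto simp: M_def)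
      then have "\<beta> v * (1/2 - M) \<le> \<beta> v * y" "\<beta> v * y \<le> \<beta> v * (M + 1/2)"
        using \<beta>_pos[of v] by auto
      with shrink[OF \<beta>_less_1[of v]] have "\<bar>x - 1/2\<bar> < M"
        unfolding 2(2) by (simp add: algebra_simps abs_if)
      then show False by (simp add: M_def)
    qed
  qed
  then have "\<bar>y - 1/2\<bar> \<le> 1/2" if "y \<in> G w" for y using farthest[OF that] by simp
  then show ?thesis unfolding abs_le_iff by fastforce
qed

end

section \<open>Interval masses of the natural measure\<close>

text \<open>
  Jensen's inequality for the concave function \<open>x\<^sup>s\<close>, with any missing weight placed at \<open>0\<close>. It is
  proved from the tangent line at the mean \<open>M = C X + D Y\<close>, in the form
  \<open>(Z/M)\<^sup>s \<le> s Z/M + (1 - s)\<close>; this covers \<open>Z = 0\<close> and total weight below \<open>1\<close> at once.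
\<close>
lemma powr_subconvex_combination:
  fixes C D X Y s :: real
  assumes "0 < s" "s \<le> 1" "0 \<le> C" "0 \<le> D" "C + D \<le> 1" "0 \<le> X" "0 \<le> Y"
  shows "C * X powr s + D * Y powr s \<le> (C * X + D * Y) powr s"
proof (cases "C * X + D * Y = 0")
  case True
  then have "C * X = 0" "D * Y = 0"
    using assms by (simp_all add: add_nonneg_eq_0_iff)
  then show ?thesis using assms by auto
next
  case False
  define M where "M = C * X + D * Y"
  have M: "M > 0" using False assms by (simp add: M_def order_less_le)
  have tangent: "Z powr s \<le> M powr s * (s * (Z / M) + (1 - s))" if "Z \<ge> 0" for Z
  proof (cases "Z = 0")
    case False
    then have "(Z / M) powr s * 1 powr (1 - s) \<le> s * (Z / M) + (1 - s) * 1"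
      using M that assms by (intro Youngs_inequality_0) auto
    then show ?thesis using M that by (simp add: powr_divide field_simps)
  qed (use M assms in auto)
  have "C * X powr s + D * Y powr s \<le>
      C * (M powr s * (s * (X / M) + (1 - s))) + D * (M powr s * (s * (Y / M) + (1 - s)))"
    using assms by (intro add_mono mult_left_mono tangent) auto
  also have "\<dots> = M powr s * (s * ((C * X + D * Y) / M) + (1 - s) * (C + D))"
    by (simp add: algebra_simps add_divide_distrib)
  also have "\<dots> \<le> M powr s * 1"
    using M assms mult_left_mono[of "C + D" 1 "1 - s"]
    by (intro mult_left_mono) (auto simp flip: M_def)
  finally show ?thesis by (simp add: M_def)
qed

text \<open>
  The existence of the positive eigenvector \<open>h\<close> for the eigenvalue \<open>1\<close> says that the matrix of the
  powers \<open>r\<^sup>s\<close> has spectral radius \<open>1\<close>. The vector \<open>h\<close> prescribes the total masses of the natural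
  measures on \<open>G True\<close> and \<open>G False\<close>.
\<close>
locale two_vertex_weights = two_vertex_ifs +
  fixes s :: real and h :: "bool \<Rightarrow> real"
  assumes s_pos: "0 < s" and h_pos: "0 < h w"
    and h_eq: "h w = \<alpha> w powr s * h w + \<beta> w powr s * h (\<not> w)"
begin

text \<open>
  The mass of those cylinders of level \<open>k\<close> whose hulls lie in \<open>[x,y]\<close>; it approximates from below the
  natural measure of \<open>[x,y]\<close>. The recursion pulls the interval back along the two first-level maps.
  Counting only whole cylinders makes power bounds such as \<open>mass k w x y \<le> (y - x) powr s\<close> valid at
  level \<open>0\<close> already, so that they can be proved by induction on the level.
\<close>
primrec mass :: "nat \<Rightarrow> bool \<Rightarrow> real \<Rightarrow> real \<Rightarrow> real" where
  "mass 0 w x y = (if x \<le> 0 \<and> 1 \<le> y then h w else 0)"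
| "mass (Suc k) w x y = \<alpha> w powr s * mass k w (x / \<alpha> w) (y / \<alpha> w) +
     \<beta> w powr s * mass k (\<not> w) ((x - (1 - \<beta> w)) / \<beta> w) ((y - (1 - \<beta> w)) / \<beta> w)"

lemma mass_nonneg: "0 \<le> mass k w x y"
  by (induction k arbitrary: w x y) (auto simp: h_pos less_imp_le)

lemma mass_le: "mass k w x y \<le> h w"
proof (induction k arbitrary: w x y)
  case (Suc k)
  then show ?case
    by (subst h_eq) (auto intro!: add_mono mult_left_mono)
qed (simp add: h_pos less_imp_le)

lemma mass_eq_0: "y < 0 \<or> 1 < x \<Longrightarrow> mass k w x y = 0"
proof (induction k arbitrary: w x y)
  case (Suc k)
  have "y / \<alpha> w < 0 \<or> 1 < x / \<alpha> w" "(y - (1 - \<beta> w)) / \<beta> w < 0 \<or> 1 < (x - (1 - \<beta> w)) / \<beta> w"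
    using Suc.prems \<alpha>_pos[of w] \<alpha>_less_1[of w] \<beta>_pos[of w] \<beta>_less_1[of w]
    by (auto simp: field_simps)
  then show ?case by (simp add: Suc.IH)
qed auto

lemma mass_clamp: "mass k w (max x 0) (min y 1) = mass k w x y"
proof (induction k arbitrary: w x y)
  case (Suc k)
  let ?R = "\<lambda>x. (x - (1 - \<beta> w)) / \<beta> w"
  have ab: "0 < \<alpha> w" "\<alpha> w < 1" "0 < \<beta> w" "\<beta> w < 1"
    by (rule \<alpha>_pos \<alpha>_less_1 \<beta>_pos \<beta>_less_1)+
  have L: "max (max x 0 / \<alpha> w) 0 = max (x / \<alpha> w) 0" "min (min y 1 / \<alpha> w) 1 = min (y / \<alpha> w) 1"
    using ab by (auto simp: max_def min_def field_simps)
  have R: "max (?R (max x 0)) 0 = max (?R x) 0" "min (?R (min y 1)) 1 = min (?R y) 1"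
    using ab by (auto simp: max_def min_def field_simps)
  have "mass k w (max x 0 / \<alpha> w) (min y 1 / \<alpha> w) = mass k w (x / \<alpha> w) (y / \<alpha> w)"
    using Suc[of w "max x 0 / \<alpha> w" "min y 1 / \<alpha> w"] Suc[of w "x / \<alpha> w" "y / \<alpha> w"] by (simp only: L)
  moreover have "mass k (\<not> w) (?R (max x 0)) (?R (min y 1)) = mass k (\<not> w) (?R x) (?R y)"
    using Suc[of "\<not> w" "?R (max x 0)" "?R (min y 1)"] Suc[of "\<not> w" "?R x" "?R y"] by (simp only: R)
  ultimately show ?case by simp
qed simp

lemma mass_left_of_gap:
  assumes "y < 1 - \<beta> w"
  shows "mass (Suc k) w x y = \<alpha> w powr s * mass k w (x / \<alpha> w) (y / \<alpha> w)"
  using assms \<beta>_pos[of w] by (simp add: mass_eq_0 divide_less_0_iff)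

lemma mass_right_of_gap:
  assumes "\<alpha> w < x"
  shows "mass (Suc k) w x y =
    \<beta> w powr s * mass k (\<not> w) ((x - (1 - \<beta> w)) / \<beta> w) ((y - (1 - \<beta> w)) / \<beta> w)"
  using assms \<alpha>_pos[of w] by (simp add: mass_eq_0)

text \<open>
  An interval that misses one of the two first-level pieces is a rescaled interval for the other
  piece, and the bound is invariant under rescaling because the mass scales with \<open>r\<^sup>s\<close>. Hence only
  intervals that span the gap have to be considered.
\<close>
lemma mass_bound_if_spanning_bound:
  assumes zero: "\<And>w x y. x \<le> 0 \<Longrightarrow> 1 \<le> y \<Longrightarrow> h w \<le> K * (y - x) powr s"
    and spanning: "\<And>k w x y. (\<And>w x y. x \<le> y \<Longrightarrow> mass k w x y \<le> K * (y - x) powr s) \<Longrightarrow>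
      x \<le> \<alpha> w \<Longrightarrow> 1 - \<beta> w \<le> y \<Longrightarrow> mass (Suc k) w x y \<le> K * (y - x) powr s"
    and "0 \<le> K" "x \<le> y"
  shows "mass k w x y \<le> K * (y - x) powr s"
  using \<open>x \<le> y\<close>
proof (induction k arbitrary: w x y)
  case 0
  then show ?case using zero \<open>0 \<le> K\<close> by auto
next
  case (Suc k)
  note ab = \<alpha>_pos[of w] \<beta>_pos[of w]
  consider "y < 1 - \<beta> w" | "\<alpha> w < x" | "x \<le> \<alpha> w" "1 - \<beta> w \<le> y" by linarith
  then show ?case
  proof cases
    case 1
    have "mass k w (x / \<alpha> w) (y / \<alpha> w) \<le> K * ((y - x) / \<alpha> w) powr s"
      using Suc.IH[of "x / \<alpha> w" "y / \<alpha> w" w] Suc.prems ab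
      by (simp add: divide_right_mono diff_divide_distrib)
    then show ?thesis
      unfolding mass_left_of_gap[OF 1] using ab Suc.prems
      by (simp add: powr_divide field_simps)
  next
    case 2
    let ?x = "(x - (1 - \<beta> w)) / \<beta> w" and ?y = "(y - (1 - \<beta> w)) / \<beta> w"
    have "?y - ?x = (y - x) / \<beta> w" by (simp add: diff_divide_distrib[symmetric])
    then have "mass k (\<not> w) ?x ?y \<le> K * ((y - x) / \<beta> w) powr s"
      using Suc.IH[of ?x ?y "\<not> w"] Suc.prems ab by (simp add: divide_right_mono)
    then show ?thesis
      unfolding mass_right_of_gap[OF 2] using ab Suc.prems
      by (simp add: powr_divide field_simps)
  next
    case 3
    then show ?thesis by (intro spanning Suc.IH)
  qed
qed

text \<open>
  Intervals that span the gap are at least as long as the smallest gap, and their mass is bounded.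
\<close>
lemma mass_powr_bound_exists:
  obtains K where "0 < K" "\<And>k w x y. x \<le> y \<Longrightarrow> mass k w x y \<le> K * (y - x) powr s"
proof
  define g where "g = min (1 - \<alpha> True - \<beta> True) (1 - \<alpha> False - \<beta> False)"
  define K where "K = max (h True) (h False) / g powr s"
  have g: "0 < g" "g \<le> 1 - \<alpha> w - \<beta> w" for w
    using gap[of True] gap[of False] by (cases w; auto simp: g_def)+
  show K: "0 < K" using g h_pos by (auto simp: K_def less_max_iff_disj)
  have wide: "h w \<le> K * (y - x) powr s" if "g \<le> y - x" for w x y
  proof -
    have "h w \<le> max (h True) (h False)" by (cases w) auto
    also have "\<dots> = K * g powr s" using g by (simp add: K_def)
    also have "\<dots> \<le> K * (y - x) powr s"
      using K g that s_pos by (intro mult_left_mono powr_mono2) auto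
    finally show ?thesis .
  qed
  show "mass k w x y \<le> K * (y - x) powr s" if "x \<le> y" for k w x y
  proof (rule mass_bound_if_spanning_bound[OF _ _ _ that])
    show "h w \<le> K * (y - x) powr s" if "x \<le> 0" "1 \<le> y" for w x y
      using that g(2)[of w] \<alpha>_pos[of w] \<beta>_pos[of w] by (intro wide) linarith
    show "mass (Suc k) w x y \<le> K * (y - x) powr s" if "x \<le> \<alpha> w" "1 - \<beta> w \<le> y" for k w x y
      using that g(2)[of w] by (intro order_trans[OF mass_le] wide) linarith
  qed (use K in simp)
qed

text \<open>
  Let \<open>A = \<alpha> w powr s\<close> be the fraction of the mass that lies in the
  left piece. When \<open>[0,y]\<close> ends at relative position \<open>Y\<close> in the right piece, the mass is at most
  \<open>h w (A + (1 - A) Y\<^sup>s)\<close> by induction, which Jensen bounds by \<open>h w (A + (1 - A) Y)\<^sup>s\<close>; and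
  \<open>A + (1 - A) Y\<close> is at most \<open>y = (1 - \<beta> w) + \<beta> w Y\<close> exactly because \<open>A \<le> 1 - \<beta> w\<close>.

  The factor \<open>h w\<close> cannot be expected for final segments: a right piece belongs to the other
  vertex, where the total mass may be larger.
\<close>
lemma mass_initial_segment:
  assumes "s \<le> 1" "\<And>w. \<alpha> w powr s \<le> 1 - \<beta> w" "0 \<le> y" "y \<le> 1"
  shows "mass k w x y \<le> h w * y powr s"
  using assms(3,4)
proof (induction k arbitrary: w x y)
  case 0
  then show ?case using h_pos[of w] by simp
next
  case (Suc k)
  note ab = \<alpha>_pos[of w] \<beta>_pos[of w]
  show ?case
  proof (cases "y < 1 - \<beta> w")
    case True
    have "\<alpha> w powr s * mass k w (x / \<alpha> w) (y / \<alpha> w) \<le> h w * y powr s"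
    proof (cases "y \<le> \<alpha> w")
      case True
      then have "mass k w (x / \<alpha> w) (y / \<alpha> w) \<le> h w * (y / \<alpha> w) powr s"
        using Suc ab by auto
      then show ?thesis using ab Suc.prems by (simp add: powr_divide field_simps)
    next
      case False
      then have "\<alpha> w powr s \<le> y powr s" using ab s_pos by (intro powr_mono2) auto
      then show ?thesis
        using mult_mono[OF _ mass_le[of k w "x / \<alpha> w" "y / \<alpha> w"], of "\<alpha> w powr s" "y powr s"]
          mass_nonneg by (simp add: mult.commute)
    qed
    then show ?thesis unfolding mass_left_of_gap[OF True] .
  next
    case False
    define A where "A = \<alpha> w powr s"
    define Y where "Y = (y - (1 - \<beta> w)) / \<beta> w"
    have Y: "0 \<le> Y" "Y \<le> 1" "y = 1 - \<beta> w + \<beta> w * Y"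
      using False Suc.prems ab by (auto simp: Y_def)
    have A: "0 \<le> A" "A \<le> 1 - \<beta> w" using assms(2)[of w] by (auto simp: A_def)
    have D: "\<beta> w powr s * h (\<not> w) = (1 - A) * h w"
      using h_eq[of w] by (simp add: A_def algebra_simps)
    have "mass (Suc k) w x y \<le> A * h w + \<beta> w powr s * (h (\<not> w) * Y powr s)"
      using mass_le[of k w] Suc.IH[OF Y(1,2), of "\<not> w"]
      by (auto simp: A_def simp flip: Y_def intro!: add_mono mult_left_mono)
    also have "\<dots> = h w * (A * 1 powr s + (1 - A) * Y powr s)"
      unfolding mult.assoc[symmetric] D by (simp add: algebra_simps)
    also have "\<dots> \<le> h w * (A * 1 + (1 - A) * Y) powr s"
      using A ab Y h_pos[of w] s_pos \<open>s \<le> 1\<close>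
      by (intro mult_left_mono powr_subconvex_combination) auto
    also have "\<dots> \<le> h w * y powr s"
    proof -
      have "(1 - \<beta> w - A) * Y \<le> (1 - \<beta> w - A) * 1" using A Y by (intro mult_left_mono) auto
      then have "A * 1 + (1 - A) * Y \<le> y" unfolding Y(3) by (simp add: algebra_simps)
      then show ?thesis
        using h_pos[of w] s_pos A Y ab by (intro mult_left_mono powr_mono2) auto
    qed
    finally show ?thesis .
  qed
qed

text \<open>
  An interval that spans the gap covers a final segment of the left piece and an initial segment
  of the right piece, of relative lengths \<open>X\<close> and \<open>Y\<close>. The left piece has mass at most \<open>C X\<^sup>s\<close> by
  induction, the right piece at most \<open>D Y\<^sup>s\<close> by the estimate for initial segments, where \<open>C\<close> and \<open>D\<close>
  are as below. As \<open>C + D \<le> 1\<close>, Jensen gives \<open>(C X + D Y)\<^sup>s\<close>. Finally \<open>C X + D Y\<close> is at most the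
  length \<open>\<alpha> w X + (1 - \<alpha> w - \<beta> w) + \<beta> w Y\<close>, since the gap pays for any excess of \<open>C\<close> over \<open>\<alpha> w\<close>
  and of \<open>D\<close> over \<open>\<beta> w\<close>: by \<open>C + D \<le> 1\<close> if both are exceeded, by \<open>C \<le> 1 - \<beta> w\<close> if only \<open>\<alpha> w\<close> is.
\<close>
lemma mass_le_length_powr:
  assumes "s \<le> 1" "\<And>w. \<alpha> w powr s \<le> 1 - \<beta> w" "\<And>w. h w \<le> 1" "x \<le> y"
  shows "mass k w x y \<le> (y - x) powr s"
proof -
  have spanning: "mass (Suc k) w x y \<le> 1 * (y - x) powr s"
    if IH: "\<And>w x y. x \<le> y \<Longrightarrow> mass k w x y \<le> 1 * (y - x) powr s"
      and span: "x \<le> \<alpha> w" "1 - \<beta> w \<le> y" for k w x y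
  proof -
    note ab = \<alpha>_pos[of w] \<beta>_pos[of w]
    \<comment> \<open>Clamping to \<open>[0,1]\<close> keeps the mass and makes the relative lengths lie in \<open>[0,1]\<close>.\<close>
    define x' y' where "x' = max x 0" and "y' = min y 1"
    have xy: "0 \<le> x'" "x' \<le> \<alpha> w" "1 - \<beta> w \<le> y'" "y' \<le> 1" "y' - x' \<le> y - x"
      using span ab by (auto simp: x'_def y'_def)
    define C D where "C = \<alpha> w powr s" and "D = \<beta> w powr s * h (\<not> w)"
    define X Y where "X = 1 - x' / \<alpha> w" and "Y = (y' - (1 - \<beta> w)) / \<beta> w"
    have X: "0 \<le> X" "X \<le> 1" "x' = \<alpha> w - \<alpha> w * X"
      using xy ab by (auto simp: X_def field_simps)
    have Y: "0 \<le> Y" "Y \<le> 1" "y' = 1 - \<beta> w + \<beta> w * Y"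
      using xy ab by (auto simp: Y_def)
    have C: "\<alpha> w \<le> C" "C \<le> 1 - \<beta> w"
      using assms(2)[of w] powr_mono'[of s 1 "\<alpha> w"] \<open>s \<le> 1\<close> ab \<alpha>_less_1[of w]
      by (auto simp: C_def)
    have D: "0 \<le> D" using h_pos[of "\<not> w"] by (simp add: D_def)
    have CD: "C + D \<le> 1"
    proof -
      have "D = (1 - C) * h w" using h_eq[of w] by (simp add: C_def D_def algebra_simps)
      also have "\<dots> \<le> (1 - C) * 1"
        using C ab assms(3)[of w] by (intro mult_left_mono) auto
      finally show ?thesis by simp
    qed
    have left: "mass k w (x' / \<alpha> w) (y' / \<alpha> w) \<le> X powr s"
    proof -
      have "mass k w (x' / \<alpha> w) (y' / \<alpha> w) = mass k w (x' / \<alpha> w) 1"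
        using mass_clamp[of k w "x' / \<alpha> w" "y' / \<alpha> w"] mass_clamp[of k w "x' / \<alpha> w" 1]
          xy ab gap[of w] by (simp add: min_def le_divide_eq)
      also have "\<dots> \<le> (1 - x' / \<alpha> w) powr s"
        using xy ab IH[of "x' / \<alpha> w" 1 w] by simp
      finally show ?thesis by (simp add: X_def)
    qed
    have right: "mass k (\<not> w) ((x' - (1 - \<beta> w)) / \<beta> w) Y \<le> h (\<not> w) * Y powr s"
      by (rule mass_initial_segment[OF assms(1,2) Y(1,2)])
    have "mass (Suc k) w x y = mass (Suc k) w x' y'"
      unfolding x'_def y'_def by (simp only: mass_clamp)
    also have "\<dots> \<le> C * X powr s + D * Y powr s"
      using left right
      by (auto simp: C_def D_def mult.assoc simp flip: Y_def intro!: add_mono mult_left_mono)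
    also have "\<dots> \<le> (C * X + D * Y) powr s"
      using s_pos \<open>s \<le> 1\<close> C D CD X Y ab by (intro powr_subconvex_combination) auto
    also have "\<dots> \<le> (y - x) powr s"
    proof -
      have "(C - \<alpha> w) * X \<le> C - \<alpha> w" using mult_left_le[of X "C - \<alpha> w"] X C by simp
      moreover have "(D - \<beta> w) * Y \<le> max (D - \<beta> w) 0"
        using mult_right_mono[of "D - \<beta> w" "max (D - \<beta> w) 0" Y] mult_left_le[of Y "max (D - \<beta> w) 0"] Y by simp
      ultimately have "C * X + D * Y \<le> y' - x'"
        using CD C unfolding X(3) Y(3) by (simp add: algebra_simps max_def split: if_splits)
      then show ?thesis
        using xy s_pos C D X Y ab by (intro powr_mono2) auto
    qed
    finally show ?thesis by simp
  qed
  have zero: "h w \<le> 1 * (y - x) powr s" if "x \<le> 0" "1 \<le> y" for w x y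
    using assms(3)[of w] ge_one_powr_ge_zero[of "y - x" s] that s_pos by auto
  have "mass k w x y \<le> 1 * (y - x) powr s"
    by (rule mass_bound_if_spanning_bound[OF zero spanning _ \<open>x \<le> y\<close>]) auto
  then show ?thesis by simp
qed

end

section \<open>The mass distribution principle\<close>

context two_vertex_ifs
begin

lemma common_ratio_bound:
  obtains \<rho> where "0 < \<rho>" "\<rho> < 1" "\<And>w. \<alpha> w \<le> \<rho>" "\<And>w. \<beta> w \<le> \<rho>"
proof
  let ?\<rho> = "Max ((\<alpha> ` UNIV) \<union> (\<beta> ` UNIV))"
  show le: "\<alpha> w \<le> ?\<rho>" "\<beta> w \<le> ?\<rho>" for w by (auto intro!: Max_ge)
  show "0 < ?\<rho>" using le(1)[of True] \<alpha>_pos[of True] by linarith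
  show "?\<rho> < 1" by (subst Max_less_iff) (auto simp: \<alpha>_less_1 \<beta>_less_1)
qed

end

context two_vertex_weights
begin

text \<open>
  If \<open>k\<close> is so large that level-\<open>k\<close> cylinders are shorter than \<open>\<delta>\<close>, each of them lies in one of the
  intervals, so no mass is lost. Only pairs of points matter since the covering sets are intervals.
\<close>
lemma sum_mass_cover:
  assumes "finite I"
    and "\<And>p q. p \<in> G w \<Longrightarrow> q \<in> G w \<Longrightarrow> p \<le> q \<Longrightarrow> q - p < \<delta> \<Longrightarrow> \<exists>i\<in>I. x i \<le> p \<and> q \<le> y i"
    and \<rho>: "0 < \<rho>" "\<And>w. \<alpha> w \<le> \<rho>" "\<And>w. \<beta> w \<le> \<rho>" and "\<rho> ^ k < \<delta>"
  shows "h w \<le> (\<Sum>i\<in>I. mass k w (x i) (y i))"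
  using assms(2,6)
proof (induction k arbitrary: w \<delta> x y)
  case 0
  then obtain i where "i \<in> I" "x i \<le> 0" "1 \<le> y i"
    using "0.prems"(1)[OF zero_in_G one_in_G] by auto
  then show ?case
    using member_le_sum[OF _ _ \<open>finite I\<close>, of i "\<lambda>i. mass 0 w (x i) (y i)"] mass_nonneg[of 0]
    by auto
next
  case (Suc k)
  note ab = \<alpha>_pos[of w] \<beta>_pos[of w]
  have small: "\<rho> ^ k < \<delta> / \<rho>" using Suc.prems(2) \<rho>(1) by (simp add: field_simps)
  have shrink: "r * (q - p) < \<delta>" if "q - p < \<delta> / \<rho>" "p \<le> q" "0 < r" "r \<le> \<rho>" for r p q
  proof -
    have "r * (q - p) \<le> \<rho> * (q - p)" using that by (intro mult_right_mono) auto
    also have "\<dots> < \<delta>" using that \<rho>(1) by (simp add: field_simps)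
    finally show ?thesis .
  qed
  have "h w \<le> (\<Sum>i\<in>I. mass k w (x i / \<alpha> w) (y i / \<alpha> w))"
  proof (rule Suc.IH[OF _ small])
    fix p q assume pq: "p \<in> G w" "q \<in> G w" "p \<le> q" "q - p < \<delta> / \<rho>"
    have "\<alpha> w * q - \<alpha> w * p < \<delta>"
      using shrink[OF pq(4,3) ab(1) \<rho>(2)] by (simp add: algebra_simps)
    then have "\<exists>i\<in>I. x i \<le> \<alpha> w * p \<and> \<alpha> w * q \<le> y i"
      using pq ab by (intro Suc.prems(1) left_image_in_G) auto
    then show "\<exists>i\<in>I. x i / \<alpha> w \<le> p \<and> q \<le> y i / \<alpha> w"
      using ab by (simp add: field_simps)
  qed
  moreover have "h (\<not> w) \<le>
      (\<Sum>i\<in>I. mass k (\<not> w) ((x i - (1 - \<beta> w)) / \<beta> w) ((y i - (1 - \<beta> w)) / \<beta> w))"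
  proof (rule Suc.IH[OF _ small])
    fix p q assume pq: "p \<in> G (\<not> w)" "q \<in> G (\<not> w)" "p \<le> q" "q - p < \<delta> / \<rho>"
    have "(\<beta> w * q + (1 - \<beta> w)) - (\<beta> w * p + (1 - \<beta> w)) < \<delta>"
      using shrink[OF pq(4,3) ab(2) \<rho>(3)] by (simp add: algebra_simps)
    then have "\<exists>i\<in>I. x i \<le> \<beta> w * p + (1 - \<beta> w) \<and> \<beta> w * q + (1 - \<beta> w) \<le> y i"
      using pq ab by (intro Suc.prems(1) right_image_in_G) auto
    then show "\<exists>i\<in>I. (x i - (1 - \<beta> w)) / \<beta> w \<le> p \<and> q \<le> (y i - (1 - \<beta> w)) / \<beta> w"
      using ab by (simp add: field_simps)
  qed
  ultimately have "\<alpha> w powr s * h w + \<beta> w powr s * h (\<not> w) \<le>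
      (\<Sum>i\<in>I. mass (Suc k) w (x i) (y i))"
    by (simp add: sum.distrib sum_distrib_left[symmetric] add_mono mult_left_mono)
  then show ?case by (simp flip: h_eq)
qed

text \<open>
  A bounded set of reals lies in a closed interval whose length is its diameter; thickening it
  slightly makes it open, as compactness needs, at an arbitrarily small cost.
\<close>
lemma exists_open_interval_enlargement:
  fixes U :: "real set"
  assumes "bounded U" "U \<noteq> {}" "e > 0"
  obtains x y where "x < y" "U \<subseteq> {x<..<y}" "(y - x) powr s \<le> diameter U powr s + e"
proof -
  define d where "d = diameter U"
  have d: "0 \<le> d" using assms by (simp add: d_def diameter_ge_0)
  have "((\<lambda>t. (d + 2 * t) powr s) \<longlongrightarrow> (d + 2 * 0) powr s) (at_right 0)"
    using s_pos d eventually_at_right_less[of "0::real"]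
    by (intro tendsto_powr' tendsto_intros) (auto elim!: eventually_mono)
  then have "\<forall>\<^sub>F t in at_right 0. (d + 2 * t) powr s < d powr s + e"
    using \<open>e > 0\<close> by (intro order_tendstoD(2)) auto
  moreover have "\<forall>\<^sub>F t in at_right (0::real). 0 < t" by (rule eventually_at_right_less)
  ultimately have "\<forall>\<^sub>F t in at_right 0. 0 < t \<and> (d + 2 * t) powr s < d powr s + e"
    by eventually_elim auto
  then obtain t where t: "0 < t" "(d + 2 * t) powr s < d powr s + e"
    using eventually_happens'[of "at_right (0::real)"] by auto
  have bdd: "bdd_above U" "bdd_below U" using \<open>bounded U\<close> by (auto intro: bounded_imp_bdd_above bounded_imp_bdd_below)
  have "Sup U \<le> d + Inf U"
  proof (rule cSup_least[OF \<open>U \<noteq> {}\<close>])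
    fix q assume "q \<in> U"
    have "q - d \<le> Inf U"
    proof (rule cInf_greatest[OF \<open>U \<noteq> {}\<close>])
      fix p assume "p \<in> U"
      then show "q - d \<le> p"
        using diameter_bounded_bound[OF \<open>bounded U\<close> \<open>q \<in> U\<close>, of p] by (simp add: d_def dist_real_def)
    qed
    then show "q \<le> d + Inf U" by simp
  qed
  moreover have "Inf U \<le> Sup U" using cInf_le_cSup[OF \<open>U \<noteq> {}\<close> bdd] .
  ultimately have "((Sup U + t) - (Inf U - t)) powr s \<le> (d + 2 * t) powr s"
    using t s_pos by (intro powr_mono2) auto
  moreover have "U \<subseteq> {Inf U - t<..<Sup U + t}"
    using t cInf_lower[OF _ bdd(2)] cSup_upper[OF _ bdd(1)] by (force simp: less_le_trans)
  moreover have "Inf U - t < Sup U + t" using t \<open>Inf U \<le> Sup U\<close> by simp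
  ultimately show thesis using t that[of "Inf U - t" "Sup U + t"] by (simp add: d_def)
qed

text \<open>
  A cover is replaced by finitely many open intervals with a Lebesgue number for the compact
  attractor, at the price of an error \<open>e\<close>. At a sufficiently deep level the masses of these intervals
  add up to at least the total mass \<open>h w\<close>.
\<close>
lemma mass_distribution_principle:
  assumes bound: "\<And>k w x y. x \<le> y \<Longrightarrow> mass k w x y \<le> K * (y - x) powr s" and "0 < K"
  shows "ennreal (h w) \<le> ennreal K * hausdorff_premeasure s \<delta> (G w)"
proof (rule le_mult_hausdorff_premeasure[OF \<open>0 < K\<close>])
  fix U :: "nat \<Rightarrow> real set"
  assume U: "G w \<subseteq> (\<Union>i. U i)" "\<And>i. bounded (U i)" "\<And>i. diameter (U i) \<le> \<delta>"
  show "ennreal (h w) \<le> ennreal K * (\<Sum>i. diam_gauge s (U i))"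
  proof (rule ennreal_le_epsilon)
    fix e :: real assume "0 < e"
    \<comment> \<open>The errors \<open>K * \<epsilon> i\<close> sum to \<open>e\<close>.\<close>
    define \<epsilon> where "\<epsilon> i = e / K * (1/2) ^ Suc i" for i
    have \<epsilon>: "\<epsilon> i > 0" for i using \<open>0 < e\<close> \<open>0 < K\<close> by (simp add: \<epsilon>_def)
    have "\<exists>x y. x < y \<and> U i \<subseteq> {x<..<y} \<and> (U i \<noteq> {} \<longrightarrow> (y - x) powr s \<le> diameter (U i) powr s + \<epsilon> i)" for i
    proof (cases "U i = {}")
      case True
      then show ?thesis by - (rule exI[of _ 0], rule exI[of _ 1], simp)
    next
      case False
      from exists_open_interval_enlargement[OF U(2) this \<epsilon>] show ?thesis by metis
    qed
    then obtain x y where xy: "\<And>i. x i < y i" "\<And>i. U i \<subseteq> {x i<..<y i}"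
        "\<And>i. U i \<noteq> {} \<Longrightarrow> (y i - x i) powr s \<le> diameter (U i) powr s + \<epsilon> i"
      by metis
    have "G w \<subseteq> (\<Union>i\<in>{i. U i \<noteq> {}}. {x i<..<y i})"
    proof
      fix p assume "p \<in> G w"
      then obtain i where "p \<in> U i" using U(1) by blast
      then show "p \<in> (\<Union>i\<in>{i. U i \<noteq> {}}. {x i<..<y i})" using xy(2)[of i] by blast
    qed
    from compactE_image[OF compact_G _ this] obtain I where
      I: "I \<subseteq> {i. U i \<noteq> {}}" "finite I" "G w \<subseteq> (\<Union>i\<in>I. {x i<..<y i})" by auto
    obtain \<eta> where \<eta>: "0 < \<eta>" "\<And>p. p \<in> G w \<Longrightarrow> \<exists>V\<in>(\<lambda>i. {x i<..<y i}) ` I. ball p \<eta> \<subseteq> V"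
    proof -
      have "open V" if "V \<in> (\<lambda>i. {x i<..<y i}) ` I" for V using that by auto
      from Heine_Borel_lemma[OF compact_G I(3) this] that show thesis by blast
    qed
    obtain \<rho> where \<rho>: "0 < \<rho>" "\<rho> < 1" "\<And>w. \<alpha> w \<le> \<rho>" "\<And>w. \<beta> w \<le> \<rho>"
      using common_ratio_bound by blast
    obtain k where k: "\<rho> ^ k < \<eta>" using real_arch_pow_inv[OF \<eta>(1) \<rho>(2)] by auto
    have "h w \<le> (\<Sum>i\<in>I. mass k w (x i) (y i))"
    proof (rule sum_mass_cover[OF I(2) _ \<rho>(1,3,4) k])
      fix p q assume pq: "p \<in> G w" "q \<in> G w" "p \<le> q" "q - p < \<eta>"
      obtain i where i: "i \<in> I" "ball p \<eta> \<subseteq> {x i<..<y i}" using \<eta>(2)[OF pq(1)] by auto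
      have "p \<in> ball p \<eta>" "q \<in> ball p \<eta>" using pq \<eta>(1) by (auto simp: dist_real_def)
      then have "p \<in> {x i<..<y i}" "q \<in> {x i<..<y i}" using i(2) by blast+
      then show "\<exists>i\<in>I. x i \<le> p \<and> q \<le> y i" using i(1) by (intro bexI[of _ i]) auto
    qed
    also have "\<dots> \<le> (\<Sum>i\<in>I. K * (diameter (U i) powr s + \<epsilon> i))"
    proof (rule sum_mono)
      fix i assume "i \<in> I"
      have "mass k w (x i) (y i) \<le> K * (y i - x i) powr s"
        using xy(1)[of i] by (intro bound) simp
      also have "\<dots> \<le> K * (diameter (U i) powr s + \<epsilon> i)"
        using xy(3)[of i] I(1) \<open>i \<in> I\<close> \<open>0 < K\<close> by (intro mult_left_mono) auto
      finally show "mass k w (x i) (y i) \<le> K * (diameter (U i) powr s + \<epsilon> i)" .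
    qed
    also have "\<dots> = K * (\<Sum>i\<in>I. diameter (U i) powr s) + K * (\<Sum>i\<in>I. \<epsilon> i)"
      by (simp add: sum.distrib sum_distrib_left distrib_left)
    also have "K * (\<Sum>i\<in>I. \<epsilon> i) \<le> e"
    proof -
      have "(\<Sum>i\<in>I. \<epsilon> i) \<le> e / K * 1"
        unfolding \<epsilon>_def sum_distrib_left[symmetric]
        using sum_le_suminf[OF sums_summable[OF power_half_series] I(2)] sums_unique[OF power_half_series] \<open>0 < e\<close> \<open>0 < K\<close>
        by (intro mult_left_mono) auto
      then show ?thesis using \<open>0 < K\<close> by (simp add: field_simps)
    qed
    finally have "ennreal (h w) \<le> ennreal (K * (\<Sum>i\<in>I. diameter (U i) powr s) + e)"
      by (simp add: ennreal_leI)
    also have "\<dots> = ennreal K * (\<Sum>i\<in>I. ennreal (diameter (U i) powr s)) + ennreal e"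
      using \<open>0 < K\<close> \<open>0 < e\<close> by (simp add: ennreal_mult sum_nonneg)
    also have "(\<Sum>i\<in>I. ennreal (diameter (U i) powr s)) = (\<Sum>i\<in>I. diam_gauge s (U i))"
      using I(1) s_pos by (intro sum.cong) (auto simp: diam_gauge_def)
    also have "\<dots> \<le> (\<Sum>i. diam_gauge s (U i))"
      using I(2) by (intro sum_le_suminf) auto
    finally show "ennreal (h w) \<le> ennreal K * (\<Sum>i. diam_gauge s (U i)) + ennreal e"
      by (simp add: mult_left_mono)
  qed
qed

end

section \<open>Finiteness, proportionality and the upper bound\<close>

context two_vertex_weights
begin

text \<open>
  Images of covers under the two first-level maps form a cover at the finer scale \<open>\<rho> \<delta>\<close>.
\<close>
lemma hausdorff_premeasure_step:
  assumes "0 < \<delta>" "\<alpha> w \<le> \<rho>" "\<beta> w \<le> \<rho>"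
  shows "hausdorff_premeasure s (\<rho> * \<delta>) (G w) \<le>
    ennreal (\<alpha> w powr s) * hausdorff_premeasure s \<delta> (G w) +
    ennreal (\<beta> w powr s) * hausdorff_premeasure s \<delta> (G (\<not> w))"
proof -
  have branch: "hausdorff_premeasure s (\<rho> * \<delta>) ((\<lambda>x. r * x + q) ` A) \<le>
      ennreal (r powr s) * hausdorff_premeasure s \<delta> A" if "0 < r" "r \<le> \<rho>" for r q A
  proof -
    have "dist (r * x + q) (r * y + q) \<le> r * dist x y" for x y
    proof -
      have "(r * x + q) - (r * y + q) = r * (x - y)" by (simp add: algebra_simps)
      then show ?thesis using that by (simp add: dist_real_def abs_mult)
    qed
    with that s_pos have "hausdorff_premeasure s (r * \<delta>) ((\<lambda>x. r * x + q) ` A) \<le>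
      ennreal (r powr s) * hausdorff_premeasure s \<delta> A"
      by (intro hausdorff_premeasure_lipschitz_image) auto
    moreover have "r * \<delta> \<le> \<rho> * \<delta>" using that \<open>0 < \<delta>\<close> by simp
    ultimately show ?thesis using hausdorff_premeasure_antimono order_trans by blast
  qed
  have "hausdorff_premeasure s (\<rho> * \<delta>) (G w) \<le>
      hausdorff_premeasure s (\<rho> * \<delta>) ((\<lambda>x. \<alpha> w * x) ` G w) +
      hausdorff_premeasure s (\<rho> * \<delta>) ((\<lambda>x. \<beta> w * x + (1 - \<beta> w)) ` G (\<not> w))"
    by (subst G_eq) (rule hausdorff_premeasure_Un)
  also have "\<dots> \<le> ennreal (\<alpha> w powr s) * hausdorff_premeasure s \<delta> (G w) +
      ennreal (\<beta> w powr s) * hausdorff_premeasure s \<delta> (G (\<not> w))"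
    using branch[of "\<alpha> w" 0] branch[of "\<beta> w" "1 - \<beta> w"] \<alpha>_pos[of w] \<beta>_pos[of w] assms
    by (intro add_mono) auto
  finally show ?thesis .
qed

lemma hausdorff_premeasure_1_le: "hausdorff_premeasure s 1 (G w) \<le> 1"
proof -
  let ?U = "\<lambda>i::nat. if i = 0 then G w else {}"
  have diam: "diameter (G w) \<le> 1"
  proof (rule diameter_le)
    fix x y assume "x \<in> G w" "y \<in> G w"
    then have "x \<in> {0..1}" "y \<in> {0..1}" using G_subset by blast+
    then show "norm (x - y) \<le> 1" by (simp add: abs_le_iff)
  qed simp
  have "diameter (G w) powr s \<le> 1"
    using diam s_pos diameter_ge_0[OF compact_imp_bounded[OF compact_G]]
    by (intro powr_le1) auto
  have "hausdorff_premeasure s 1 (G w) \<le> (\<Sum>i. diam_gauge s (?U i))"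
    using diam compact_imp_bounded[OF compact_G, of w] by (intro hausdorff_premeasure_le_cover) auto
  also have "\<dots> = diam_gauge s (G w)"
    using suminf_finite[of "{0}" "\<lambda>i. diam_gauge s (?U i)"] by (simp add: diam_gauge_def)
  also have "\<dots> \<le> ennreal 1"
    unfolding diam_gauge_def using \<open>diameter (G w) powr s \<le> 1\<close> G_nonempty s_pos
    by (auto intro!: ennreal_leI simp del: ennreal_1)
  finally show ?thesis by simp
qed

text \<open>
  The vector of premeasures at scale \<open>1\<close> lies below a multiple of the eigenvector \<open>h\<close>, and each
  refinement step preserves this bound.
\<close>
lemma hausdorff_measure_finite: "hausdorff_measure s (G w) < top"
proof -
  obtain \<rho> where \<rho>: "0 < \<rho>" "\<rho> < 1" "\<And>w. \<alpha> w \<le> \<rho>" "\<And>w. \<beta> w \<le> \<rho>"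
    using common_ratio_bound by blast
  define C where "C = 1 / min (h True) (h False)"
  have C: "0 < C" "1 \<le> C * h w" for w
    using h_pos by (cases w; auto simp: C_def field_simps min_def)+
  have bound: "hausdorff_premeasure s (\<rho> ^ k) (G w) \<le> ennreal (C * h w)" for k w
  proof (induction k arbitrary: w)
    case 0
    show ?case
      using order_trans[OF hausdorff_premeasure_1_le[of w], of "ennreal (C * h w)"] C(2)[of w]
      by simp
  next
    case (Suc k)
    have "hausdorff_premeasure s (\<rho> ^ Suc k) (G w) \<le>
        ennreal (\<alpha> w powr s) * hausdorff_premeasure s (\<rho> ^ k) (G w) +
        ennreal (\<beta> w powr s) * hausdorff_premeasure s (\<rho> ^ k) (G (\<not> w))"
      using hausdorff_premeasure_step[of "\<rho> ^ k" w \<rho>] \<rho> by simp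
    also have "\<dots> \<le> ennreal (\<alpha> w powr s) * ennreal (C * h w) +
        ennreal (\<beta> w powr s) * ennreal (C * h (\<not> w))"
      by (intro add_mono mult_left_mono Suc) auto
    also have "\<dots> = ennreal (C * (\<alpha> w powr s * h w + \<beta> w powr s * h (\<not> w)))"
      using C(1) h_pos[of w] h_pos[of "\<not> w"]
      by (simp add: ennreal_mult[symmetric] ennreal_plus[symmetric] algebra_simps del: ennreal_plus)
    finally show ?case by (simp flip: h_eq)
  qed
  have "hausdorff_measure s (G w) = (SUP k. hausdorff_premeasure s (\<rho> ^ k) (G w))"
    using \<rho> by (intro hausdorff_measure_eq_SUP_seq LIMSEQ_power_zero) auto
  also have "\<dots> \<le> ennreal (C * h w)" by (intro SUP_least bound)
  finally show ?thesis by (rule le_less_trans) simp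
qed

lemma hausdorff_measure_pos: "hausdorff_measure s (G w) \<noteq> 0"
proof -
  obtain K where K: "0 < K" "\<And>k w x y. x \<le> y \<Longrightarrow> mass k w x y \<le> K * (y - x) powr s"
    using mass_powr_bound_exists by blast
  have "ennreal (h w) \<le> ennreal K * hausdorff_premeasure s 1 (G w)"
    using mass_distribution_principle[OF K(2,1)] .
  also have "\<dots> \<le> ennreal K * hausdorff_measure s (G w)"
    by (intro mult_left_mono hausdorff_premeasure_le_measure) auto
  finally show ?thesis using h_pos[of w] by auto
qed

lemma hausdorff_dim_eq: "hausdorff_dim (G w) = ereal s"
  using s_pos hausdorff_measure_pos hausdorff_measure_finite by (intro hausdorff_dim_eqI) auto

text \<open>
  By subadditivity the vector \<open>\<eta>\<close> of measures satisfies \<open>\<eta> \<le> M \<eta>\<close>, where \<open>M\<close> is the matrix of which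
  \<open>h\<close> is an eigenvector. At each vertex this says that \<open>\<eta> w / h w\<close> is at most the same ratio at the
  other vertex, hence the two ratios agree.
\<close>
lemma hausdorff_measure_proportional:
  obtains c where "0 < c" "\<And>w. hausdorff_measure s (G w) = ennreal (c * h w)"
proof -
  define \<eta> where "\<eta> w = enn2real (hausdorff_measure s (G w))" for w
  have \<eta>: "hausdorff_measure s (G w) = ennreal (\<eta> w)" for w
    using hausdorff_measure_finite[of w] by (simp add: \<eta>_def)
  have pos: "0 < \<eta> w" for w
    using hausdorff_measure_pos[of w] hausdorff_measure_finite[of w]
    by (simp add: \<eta>_def enn2real_positive_iff zero_less_iff_neq_zero)
  have sub: "\<eta> w \<le> \<alpha> w powr s * \<eta> w + \<beta> w powr s * \<eta> (\<not> w)" for w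
  proof -
    have "hausdorff_measure s (G w) \<le>
        hausdorff_measure s ((\<lambda>x. \<alpha> w * x + 0) ` G w) +
        hausdorff_measure s ((\<lambda>x. \<beta> w * x + (1 - \<beta> w)) ` G (\<not> w))"
      by (subst G_eq) (simp add: hausdorff_measure_Un)
    also have "\<dots> = ennreal (\<alpha> w powr s) * ennreal (\<eta> w) + ennreal (\<beta> w powr s) * ennreal (\<eta> (\<not> w))"
      unfolding \<eta>[symmetric] using \<alpha>_pos[of w] \<beta>_pos[of w] s_pos
      by (subst (1 2) hausdorff_measure_affine_image) auto
    also have "\<dots> = ennreal (\<alpha> w powr s * \<eta> w + \<beta> w powr s * \<eta> (\<not> w))"
      using pos[of w] pos[of "\<not> w"]
      by (simp add: ennreal_mult ennreal_plus)
    finally show ?thesis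
      using pos[of w] pos[of "\<not> w"] unfolding \<eta> by (subst (asm) ennreal_le_iff) (auto simp: add_nonneg_nonneg)
  qed
  have cross: "\<eta> w * h (\<not> w) \<le> \<eta> (\<not> w) * h w" for w
  proof -
    have "\<beta> w powr s * h (\<not> w) = (1 - \<alpha> w powr s) * h w"
      using h_eq[of w] by (simp add: algebra_simps)
    then have "\<beta> w powr s * (\<eta> w * h (\<not> w)) = \<eta> w * ((1 - \<alpha> w powr s) * h w)"
      by (simp add: mult.left_commute)
    also have "\<dots> = ((1 - \<alpha> w powr s) * \<eta> w) * h w" by simp
    also have "\<dots> \<le> (\<beta> w powr s * \<eta> (\<not> w)) * h w"
      using sub[of w] h_pos[of w] by (intro mult_right_mono) (auto simp: algebra_simps)
    finally show ?thesis using \<beta>_pos[of w] by (simp add: mult.assoc)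
  qed
  have eq: "\<eta> False * h True = \<eta> True * h False" using cross[of True] cross[of False] by simp
  have "\<eta> w = \<eta> True / h True * h w" for w
    using h_pos[of True] by (cases w) (simp_all add: eq[symmetric])
  then have "hausdorff_measure s (G w) = ennreal (\<eta> True / h True * h w)" for w
    unfolding \<eta> by (rule arg_cong)
  moreover have "0 < \<eta> True / h True" using pos[of True] h_pos[of True] by simp
  ultimately show thesis by (intro that)
qed

text \<open>
  Passing to a finer scale increases the premeasures, yet it does not increase their sum weighted
  by the left eigenvector \<open>p\<close>. Hence the premeasures are the same at all scales up to \<open>1\<close>, and the
  cover by the single set \<open>G w\<close> already bounds the measure.
\<close>
lemma hausdorff_measure_le_1: "hausdorff_measure s (G w) \<le> 1"
proof -
  obtain \<rho> where \<rho>: "0 < \<rho>" "\<rho> < 1" "\<And>w. \<alpha> w \<le> \<rho>" "\<And>w. \<beta> w \<le> \<rho>"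
    using common_ratio_bound by blast
  define P where "P k w = enn2real (hausdorff_premeasure s (\<rho> ^ k) (G w))" for k w
  define \<eta> where "\<eta> w = enn2real (hausdorff_measure s (G w))" for w
  have le_measure: "hausdorff_premeasure s (\<rho> ^ k) (G w) \<le> hausdorff_measure s (G w)" for k w
    using \<rho> by (intro hausdorff_premeasure_le_measure) simp
  have fin: "hausdorff_premeasure s (\<rho> ^ k) (G w) < top" for k w
    using le_less_trans[OF le_measure hausdorff_measure_finite] .
  have P: "hausdorff_premeasure s (\<rho> ^ k) (G w) = ennreal (P k w)" "0 \<le> P k w" for k w
    using fin[of k w] by (simp_all add: P_def)
  have \<eta>: "hausdorff_measure s (G w) = ennreal (\<eta> w)" "0 \<le> \<eta> w" for w
    using hausdorff_measure_finite[of w] by (simp_all add: \<eta>_def)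
  have P_le: "P k w \<le> \<eta> w" for k w
    using le_measure[of k w] \<eta>[of w] P by simp
  have P_0: "P 0 w \<le> 1"
    using hausdorff_premeasure_1_le[of w] P[of 0 w] by simp
  have lim: "(\<lambda>k. P k w) \<longlonglongrightarrow> \<eta> w" for w
    unfolding P_def
  proof (rule tendsto_enn2real[OF _ \<eta>(2)])
    have "incseq (\<lambda>k. hausdorff_premeasure s (\<rho> ^ k) (G w))"
      using \<rho> by (intro incseq_SucI hausdorff_premeasure_antimono) (simp add: mult_left_le_one_le)
    moreover have "hausdorff_measure s (G w) = (SUP k. hausdorff_premeasure s (\<rho> ^ k) (G w))"
      using \<rho> by (intro hausdorff_measure_eq_SUP_seq LIMSEQ_power_zero) auto
    ultimately show "(\<lambda>k. hausdorff_premeasure s (\<rho> ^ k) (G w)) \<longlonglongrightarrow> ennreal (\<eta> w)"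
      unfolding \<eta>(1)[symmetric] by (metis LIMSEQ_SUP)
  qed
  have step: "P (Suc k) w \<le> \<alpha> w powr s * P k w + \<beta> w powr s * P k (\<not> w)" for k w
  proof -
    have "ennreal (P (Suc k) w) \<le> ennreal (\<alpha> w powr s) * ennreal (P k w) +
        ennreal (\<beta> w powr s) * ennreal (P k (\<not> w))"
      using hausdorff_premeasure_step[of "\<rho> ^ k" w \<rho>] \<rho> by (simp flip: P)
    also have "\<dots> = ennreal (\<alpha> w powr s * P k w + \<beta> w powr s * P k (\<not> w))"
      using P by (simp add: ennreal_mult ennreal_plus)
    finally show ?thesis
      using P by (subst (asm) ennreal_le_iff) (auto simp: add_nonneg_nonneg)
  qed
  define p where "p w = \<beta> (\<not> w) powr s * h w" for w
  have p_pos: "0 < p w" for w using \<beta>_pos[of "\<not> w"] h_pos[of w] by (simp add: p_def)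
  have p_eigen: "p w * \<alpha> w powr s + p (\<not> w) * \<beta> (\<not> w) powr s = p w" for w
  proof -
    have "p w * \<alpha> w powr s + p (\<not> w) * \<beta> (\<not> w) powr s =
        \<beta> (\<not> w) powr s * (\<alpha> w powr s * h w + \<beta> w powr s * h (\<not> w))"
      by (simp add: p_def algebra_simps)
    then show ?thesis by (simp add: p_def flip: h_eq)
  qed
  have decreasing: "p w * P k w + p (\<not> w) * P k (\<not> w) \<le> p w * P 0 w + p (\<not> w) * P 0 (\<not> w)" for k
  proof (induction k)
    case (Suc k)
    have "p w * P (Suc k) w + p (\<not> w) * P (Suc k) (\<not> w) \<le>
        p w * (\<alpha> w powr s * P k w + \<beta> w powr s * P k (\<not> w)) +
        p (\<not> w) * (\<alpha> (\<not> w) powr s * P k (\<not> w) + \<beta> (\<not> w) powr s * P k w)"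
      using step[of k w] step[of k "\<not> w"] p_pos[of w] p_pos[of "\<not> w"]
      by (intro add_mono mult_left_mono) auto
    also have "\<dots> = (p w * \<alpha> w powr s + p (\<not> w) * \<beta> (\<not> w) powr s) * P k w +
        (p (\<not> w) * \<alpha> (\<not> w) powr s + p w * \<beta> w powr s) * P k (\<not> w)"
      by (simp add: algebra_simps)
    also have "\<dots> = p w * P k w + p (\<not> w) * P k (\<not> w)"
      using p_eigen[of w] p_eigen[of "\<not> w"] by simp
    finally show ?case using Suc by simp
  qed simp
  have "p w * \<eta> w + p (\<not> w) * \<eta> (\<not> w) \<le> p w * P 0 w + p (\<not> w) * P 0 (\<not> w)"
    by (rule LIMSEQ_le_const2[OF tendsto_add[OF tendsto_mult_left[OF lim] tendsto_mult_left[OF lim]]])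
       (use decreasing in auto)
  also have "\<dots> \<le> p w * 1 + p (\<not> w) * \<eta> (\<not> w)"
    using P_0 P_le p_pos by (intro add_mono mult_left_mono) (auto intro: less_imp_le)
  finally have "\<eta> w \<le> 1" using p_pos[of w] by simp
  then show ?thesis by (simp add: \<eta>(1))
qed

end

section \<open>The dimension and the value of the measure\<close>

context two_vertex_ifs
begin

text \<open>
  The characteristic equation \<open>(1 - \<alpha>\<^sub>u\<^sup>s) (1 - \<alpha>\<^sub>v\<^sup>s) = \<beta>\<^sub>u\<^sup>s \<beta>\<^sub>v\<^sup>s\<close> is solved by the intermediate value theorem:
  the difference of its sides is \<open>-1\<close> at \<open>s = 0\<close>, and nonnegative at \<open>s = 1\<close> because of the gaps.
\<close>
lemma weights_exist:
  obtains s h where "two_vertex_weights \<alpha> \<beta> G s h" "s \<le> 1" "h True = 1"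
    "h False = (1 - \<alpha> True powr s) / \<beta> True powr s"
proof -
  define f where "f s = (1 - \<alpha> True powr s) * (1 - \<alpha> False powr s) - \<beta> True powr s * \<beta> False powr s" for s
  have nz: "\<alpha> w \<noteq> 0" "\<beta> w \<noteq> 0" for w using \<alpha>_pos[of w] \<beta>_pos[of w] by auto
  have f0: "f 0 = -1" using nz by (simp add: f_def)
  have "\<beta> True * \<beta> False \<le> (1 - \<alpha> True) * (1 - \<alpha> False)"
    using gap[of True] gap[of False] \<beta>_pos[of True] \<beta>_pos[of False] by (intro mult_mono) auto
  then have f1: "0 \<le> f 1" using \<alpha>_pos \<beta>_pos by (simp add: f_def less_imp_le)
  have "continuous_on {0..1} f"
    unfolding f_def using nz by (intro continuous_intros) auto
  then obtain s where s: "0 \<le> s" "s \<le> 1" "f s = 0"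
    using IVT'[of f 0 0 1] f0 f1 by auto
  then have "0 < s" using f0 by (cases "s = 0") auto
  define h where "h w = (if w then 1 else (1 - \<alpha> True powr s) / \<beta> True powr s)" for w
  have lt1: "\<alpha> w powr s < 1" for w
    using powr_less_mono2[OF \<open>0 < s\<close> _ \<alpha>_less_1[of w]] \<alpha>_pos[of w] by simp
  have bpos: "0 < \<beta> w powr s" for w using \<beta>_pos[of w] by simp
  have "two_vertex_weights \<alpha> \<beta> G s h"
  proof unfold_locales
    fix w
    show "0 < h w" using lt1[of True] bpos[of True] by (simp add: h_def)
    show "h w = \<alpha> w powr s * h w + \<beta> w powr s * h (\<not> w)"
      using s(3) bpos[of True] by (cases w) (auto simp: h_def f_def field_simps)
  qed fact
  then show thesis using that[of s h] s(2) by (simp add: h_def)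
qed

text \<open>
  The exponent of a system of weights is the dimension, since the measure for that exponent is
  positive and finite.
\<close>
lemma weights_at_dimension:
  assumes "hausdorff_dim (G True) = ereal s"
  obtains h where "two_vertex_weights \<alpha> \<beta> G s h" "s \<le> 1" "h True = 1"
    "h False = (1 - \<alpha> True powr s) / \<beta> True powr s"
proof -
  obtain t h where W: "two_vertex_weights \<alpha> \<beta> G t h" "t \<le> 1" "h True = 1"
      "h False = (1 - \<alpha> True powr t) / \<beta> True powr t"
    by (rule weights_exist)
  interpret W: two_vertex_weights \<alpha> \<beta> G t h by fact
  have "t = s" using assms W.hausdorff_dim_eq[of True] by simp
  with W that show thesis by simp
qed

text \<open>
  Proportionality of the measures to \<open>h\<close> turns the comparison of the measures into \<open>h False \<le> 1\<close>.
  This in turn yields at the vertex \<open>False\<close> the inequality that is assumed at \<open>True\<close>: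
  \<open>\<beta> \<le> \<beta>\<^sup>s = (1 - \<alpha>\<^sup>s) h False \<le> 1 - \<alpha>\<^sup>s\<close>. So the sharp mass estimate is available at both vertices.
\<close>
lemma hausdorff_measure_eq_1:
  assumes dim: "hausdorff_dim (G True) = ereal s"
    and le: "hausdorff_measure s (G False) \<le> hausdorff_measure s (G True)"
    and left: "\<alpha> True powr s \<le> 1 - \<beta> True"
  shows "hausdorff_measure s (G True) = 1"
    and "hausdorff_measure s (G False) = ennreal ((1 - \<alpha> True powr s) / \<beta> True powr s)"
proof -
  obtain h where W: "two_vertex_weights \<alpha> \<beta> G s h" "s \<le> 1" "h True = 1"
      "h False = (1 - \<alpha> True powr s) / \<beta> True powr s"
    by (rule weights_at_dimension[OF dim])
  interpret W: two_vertex_weights \<alpha> \<beta> G s h by fact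
  obtain c where c: "0 < c" "\<And>w. hausdorff_measure s (G w) = ennreal (c * h w)"
    using W.hausdorff_measure_proportional by auto
  have h_False: "h False \<le> 1"
    using le c(1) W.h_pos[of False] unfolding c(2) W(3) by (subst (asm) ennreal_le_iff) auto
  then have h_le: "h w \<le> 1" for w using W(3) by (cases w) auto
  have left': "\<alpha> w powr s \<le> 1 - \<beta> w" for w
  proof (cases w)
    case False
    have "\<beta> False \<le> \<beta> False powr s"
      using powr_mono'[of s 1 "\<beta> False"] W(2) \<beta>_pos[of False] \<beta>_less_1[of False] by simp
    also have "\<dots> = (1 - \<alpha> False powr s) * h False"
      using W.h_eq[of False] W(3) by (simp add: algebra_simps)
    also have "\<dots> \<le> 1 - \<alpha> False powr s"
    proof -
      have "\<alpha> False powr s \<le> 1"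
        using \<alpha>_pos[of False] \<alpha>_less_1[of False] W.s_pos by (intro powr_le1) auto
      then show ?thesis using mult_left_le[OF h_False] by simp
    qed
    finally show ?thesis using False by simp
  qed (use left in simp)
  have "ennreal (h True) \<le> ennreal 1 * hausdorff_premeasure s 1 (G True)"
  proof (rule W.mass_distribution_principle)
    show "W.mass k w x y \<le> 1 * (y - x) powr s" if "x \<le> y" for k w x y
      using W.mass_le_length_powr[OF W(2) _ h_le that] left' by simp
  qed simp
  also have "\<dots> \<le> hausdorff_measure s (G True)"
    by (simp add: hausdorff_premeasure_le_measure)
  finally show eq1: "hausdorff_measure s (G True) = 1"
    using W.hausdorff_measure_le_1[of True] W(3) by simp
  then have "c = 1" using c(2)[of True] c(1) W(3) by simp
  then show "hausdorff_measure s (G False) = ennreal ((1 - \<alpha> True powr s) / \<beta> True powr s)"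
    using c(2)[of False] W(4) by simp
qed

end

lemma hausdorff_dim_affine_image:
  fixes A :: "real set"
  assumes "r > 0"
  shows "hausdorff_dim ((\<lambda>x. r * x + q) ` A) = hausdorff_dim A"
proof -
  have "hausdorff_measure t ((\<lambda>x. r * x + q) ` A) = 0 \<longleftrightarrow> hausdorff_measure t A = 0" if "0 \<le> t" for t
    using hausdorff_measure_affine_image[OF assms that, of q A] assms by simp
  then show ?thesis unfolding hausdorff_dim_def by metis
qed

theorem theorem4p6:
  fixes a_u b_u a_v b_v a g_u b c g_v d r1 r2 r3 r4 s :: real
    and Fu Fv :: "real set"
    and h_u h_v :: ennreal
  assumes "a_u < b_u" and "a_v < b_v"
    and "a > 0" and "g_u > 0" and "b > 0" and "c > 0" and "g_v > 0" and "d > 0"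
    and "b_u - a_u = a + g_u + b" and "b_v - a_v = c + g_v + d"
    and "r1 = a / (b_u - a_u)" and "r2 = b / (b_v - a_v)"
    and "r3 = c / (b_v - a_v)" and "r4 = d / (b_u - a_u)"
    and "r1 \<in> {0<..<1}" and "r2 \<in> {0<..<1}" and "r3 \<in> {0<..<1}" and "r4 \<in> {0<..<1}"
    and "two_vertex_attractors
           (line_similarity r1 a_u a_u) (line_similarity r2 a_v (a_u + a + g_u))
           (line_similarity r3 a_v a_v) (line_similarity r4 a_u (a_v + c + g_v)) Fu Fv"
    and "ereal s = hausdorff_dim Fu" and "ereal s = hausdorff_dim Fv"
    and "h_u = hausdorff_measure s Fu" and "h_v = hausdorff_measure s Fv"
    and "b_u - a_u = b_v - a_v"
    and "h_v / h_u \<le> 1"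
    and "(a + g_u) * ((b_u - a_u) powr s - a powr s) / (b * a powr s) \<ge> 1"
  shows "hausdorff_measure s Fu = ennreal ((b_u - a_u) powr s) \<and>
         hausdorff_measure s Fv =
           ennreal ((b_u - a_u) powr s * ((1 - r1 powr s) / r2 powr s))"
proof -
  define L where "L = b_u - a_u"
  have L: "0 < L" "L = a + g_u + b" "L = c + g_v + d" "b_u - a_u = L" "b_v - a_v = L"
    using assms(1,9,10,24) by (simp_all add: L_def)
  have r: "L * r1 = a" "L * r2 = b" "L * r3 = c" "L * r4 = d"
    using L(1) assms(11-14) unfolding L(4,5) by simp_all
  define \<alpha> \<beta> where "\<alpha> w = (if w then r1 else r3)" and "\<beta> w = (if w then r2 else r4)" for w
  define G where "G w = (\<lambda>x. (x - (if w then a_u else a_v)) / L) ` (if w then Fu else Fv)" for w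
  from assms(19) have F: "compact Fu" "Fu \<noteq> {}" "compact Fv" "Fv \<noteq> {}"
    and Fu: "Fu = line_similarity r1 a_u a_u ` Fu \<union> line_similarity r2 a_v (a_u + a + g_u) ` Fv"
    and Fv: "Fv = line_similarity r3 a_v a_v ` Fv \<union> line_similarity r4 a_u (a_v + c + g_v) ` Fu"
    unfolding two_vertex_attractors_def by auto
  have unscale: "Fu = (\<lambda>x. L * x + a_u) ` G True" "Fv = (\<lambda>x. L * x + a_v) ` G False"
    using L(1) by (simp_all add: G_def image_image)
  interpret two_vertex_ifs \<alpha> \<beta> G
  proof
    fix w
    show "0 < \<alpha> w" "0 < \<beta> w" using assms(15-18) by (auto simp: \<alpha>_def \<beta>_def)
    have "L * (r1 + r2) < L * 1" "L * (r3 + r4) < L * 1"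
      using L assms(4,7) r by (auto simp: distrib_left)
    then show "\<alpha> w + \<beta> w < 1" using L(1) by (auto simp: \<alpha>_def \<beta>_def)
    show "compact (G w)" unfolding G_def using F L(1) by (intro compact_continuous_image continuous_intros) auto
    show "G w \<noteq> {}" using F by (simp add: G_def)
    have gaps: "(a + g_u) / L = 1 - r2" "(c + g_v) / L = 1 - r4"
      using L r by (simp_all add: field_simps)
    have eq: "(line_similarity r p q x - o') / L = r * ((x - p) / L) + (q - o') / L" for r p q x o'
      by (simp add: line_similarity_def add_diff_eq[symmetric] add_divide_distrib)
    have shifts: "(a_u + a + g_u - a_u) / L = (a + g_u) / L" "(a_v + c + g_v - a_v) / L = (c + g_v) / L"
      by simp_all
    show "G w = (\<lambda>x. \<alpha> w * x) ` G w \<union> (\<lambda>x. \<beta> w * x + (1 - \<beta> w)) ` G (\<not> w)"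
    proof (cases w)
      case True
      have "G True = (\<lambda>x. (x - a_u) / L) `
          (line_similarity r1 a_u a_u ` Fu \<union> line_similarity r2 a_v (a_u + a + g_u) ` Fv)"
        unfolding G_def by (simp flip: Fu)
      also have "\<dots> = (\<lambda>x. r1 * x) ` G True \<union> (\<lambda>x. r2 * x + (1 - r2)) ` G False"
        unfolding G_def image_Un image_image eq shifts gaps by simp
      finally show ?thesis using True by (simp add: \<alpha>_def \<beta>_def)
    next
      case False
      have "G False = (\<lambda>x. (x - a_v) / L) `
          (line_similarity r3 a_v a_v ` Fv \<union> line_similarity r4 a_u (a_v + c + g_v) ` Fu)"
        unfolding G_def by (simp flip: Fv)
      also have "\<dots> = (\<lambda>x. r3 * x) ` G False \<union> (\<lambda>x. r4 * x + (1 - r4)) ` G True"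
        unfolding G_def image_Un image_image eq shifts gaps by simp
      finally show ?thesis using False by (simp add: \<alpha>_def \<beta>_def)
    qed
  qed
  have dim: "hausdorff_dim (G True) = ereal s"
    using assms(20) hausdorff_dim_affine_image[OF L(1), of a_u "G True"] unscale(1) by simp
  then obtain h where "two_vertex_weights \<alpha> \<beta> G s h"
    using weights_at_dimension by metis
  then interpret W: two_vertex_weights \<alpha> \<beta> G s h .
  have s: "0 < s" by (rule W.s_pos)
  have scaled: "hausdorff_measure s Fu = ennreal (L powr s) * hausdorff_measure s (G True)"
    "hausdorff_measure s Fv = ennreal (L powr s) * hausdorff_measure s (G False)"
    using hausdorff_measure_affine_image[OF L(1), of s] s by (subst unscale, simp)+
  obtain k where k: "0 < k" "\<And>w. hausdorff_measure s (G w) = ennreal (k * h w)"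
    using W.hausdorff_measure_proportional by auto
  have "hausdorff_measure s (G False) \<le> hausdorff_measure s (G True)"
  proof -
    have pos: "0 < L powr s * (k * h w)" for w using L(1) k(1) W.h_pos[of w] by simp
    have "h_u = ennreal (L powr s * (k * h True))" "h_v = ennreal (L powr s * (k * h False))"
      using pos assms(22,23) scaled k by (simp_all add: ennreal_mult')
    then have "ennreal (L powr s * (k * h False) / (L powr s * (k * h True))) \<le> ennreal 1"
      using assms(25) pos[of True] pos[of False] by (simp add: divide_ennreal)
    then have "L powr s * (k * h False) / (L powr s * (k * h True)) \<le> 1"
      by (subst (asm) ennreal_le_iff) auto
    then have "k * h False \<le> k * h True"
      using pos[of True] k(1) L(1) W.h_pos[of True] by (simp add: divide_le_eq)
    then show ?thesis unfolding k by (rule ennreal_leI)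
  qed
  \<comment> \<open>The third hypothesis says that \<open>a\<^sup>s / L\<^sup>s \<le> (a + g\<^sub>u) / L\<close>.\<close>
  moreover have "\<alpha> True powr s \<le> 1 - \<beta> True"
  proof -
    have "1 * (b * a powr s) \<le> (a + g_u) * (L powr s - a powr s)"
      using assms(26,3,5) unfolding L(4) by (subst (asm) le_divide_eq) auto
    then have "L * a powr s \<le> (a + g_u) * L powr s" using L(2) by (simp add: algebra_simps)
    moreover have "a powr s = L powr s * r1 powr s" using L(1) assms(15) by (simp flip: r powr_mult)
    moreover have "a + g_u = L * (1 - r2)" using L(2) r by (simp add: algebra_simps)
    ultimately have "(L * L powr s) * r1 powr s \<le> (L * L powr s) * (1 - r2)" by (simp add: ac_simps)
    then show ?thesis using L(1) by (simp add: \<alpha>_def \<beta>_def)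
  qed
  ultimately have "hausdorff_measure s (G True) = 1"
    "hausdorff_measure s (G False) = ennreal ((1 - r1 powr s) / r2 powr s)"
    using hausdorff_measure_eq_1[OF dim] by (simp_all add: \<alpha>_def \<beta>_def)
  then show ?thesis unfolding scaled L(4) by (simp add: ennreal_mult' del: times_divide_eq_right)
qed

end
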